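(* Let $\mathcal{X}:=\mathbb{R}^{m_1\times n_1}\times\cdots\times\mathbb{R}^{m_J\times n_J}$, let $L_1,\dots,L_J>0$, let $\alpha\in[2,\infty]$, $\beta\in[1,2]$ be a conjugate pair, and for each $j\in[J]$ let $p_j\in[2,\infty]$, $q_j\in[1,2]$ be a conjugate pair. Let $\|\cdot\|_{\mathbf w,\mathbf p}$ and its dual norm $\|\cdot\|_{\mathbf v,\mathbf q}$ be the mixed norms defined in the context. For $\mathbf M\in\mathcal{X}$ consider the problems $$\text{(ball)}\quad\min_{\|\mathbf Z\|_{\mathbf w,\mathbf p}\le1}\langle\mathbf M,\mathbf Z\rangle,\qquad\text{(regularization)}\quad\min_{\mathbf Z\in\mathcal{X}}\Big\{\langle\mathbf M,\mathbf Z\rangle+\frac12\|\mathbf Z\|_{\mathbf w,\mathbf p}^2\Big\}.$$ If $\|\mathbf M\|_{\mathbf v,\mathbf q}=0$, then $\mathbf Z=0$ is a minimizer of both problems. If $\|\mathbf M\|_{\mathbf v,\mathbf q}>0$, then the point $\mathbf Z_{\rm b}\in\mathcal{X}$ with blocks $$[\mathbf Z_{\rm b}]_j=L_j^{-1/2}\left(\frac{L_j^{-1/2}\|[M]_j\|_{S_{q_j}}}{\|\mathbf M\|_{\mathbf v,\mathbf q}}\right)^{\beta-1}\Delta_{p_j}^{\rm b}([M]_j),\qquad j\in[J],$$ is a minimizer of the ball problem, and the point $\mathbf Z_{\rm r}$ with blocks $[\mathbf Z_{\rm r}]_j=\|\mathbf M\|_{\mathbf v,\mathbf q}\,[\mathbf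 Z_{\rm b}]_j$, $j\in[J]$, is a minimizer of the regularization problem.
   Context: $[M]_j\in\mathbb{R}^{m_j\times n_j}$ is the $j$th block of $\mathbf M\in\mathcal{X}$, and $[J]=\{1,\dots,J\}$. $\|Z\|_{S_r}$ is the Schatten-$r$ norm (the $\ell_r$ norm of the singular values). Exponents $a,b\in[1,\infty]$ are conjugate if $1/a+1/b=1$ with $1/\infty:=0$. The inner product on $\mathcal{X}$ is $\langle\mathbf X,\mathbf Y\rangle=\sum_{j=1}^J\langle[X]_j,[Y]_j\rangle$ with the trace inner product on each block. The mixed norms are $$\|\mathbf X\|_{\mathbf w,\mathbf p}:=\big\|\big(L_j^{1/2}\|[X]_j\|_{S_{p_j}}\big)_{j=1}^J\big\|_\alpha,\qquad\|\mathbf X\|_{\mathbf v,\mathbf q}:=\big\|\big(L_j^{-1/2}\|[X]_j\|_{S_{q_j}}\big)_{j=1}^J\big\|_\beta,$$ with $\ell_\alpha$, $\ell_\beta$ norms on $\mathbb{R}^J$. For a conjugate pair $p\in[2,\infty]$, $q\in[1,2]$ and a matrix $M$, $\Delta_p^{\rm b}(M)$ denotes the following selected minimizer of $\langle M,Z\rangle$ over $\|Z\|_{S_p}\le1$: $\Delta_p^{\rm b}(0)=0$, and $\Delta_p^{\rm b}(M)=-M(M^TM)^{\frac{q-2}{2}}/\|M\|_{S_q}^{q-1}$ if $M\neq0$. Here, for positive semidefinite $A=U\mathrm{diag}(\sigma_i)U^T$, $A^a:=U\mathrm{diag}(\sigma_i^a)U^T$ for $a\ge0$ and $A^a:=(A^+)^{-a}$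 for $a<0$, with $A^+$ the Moore–Penrose pseudoinverse. *)

theory Defs
  imports
    "HOL-Library.Extended_Real"
    "HOL-Library.Multiset"
    "Jordan_Normal_Form.Char_Poly"
begin

definition conjugate_exponents :: "ereal \<Rightarrow> ereal \<Rightarrow> bool" where
  "conjugate_exponents a b \<longleftrightarrow> 1 \<le> a \<and> 1 \<le> b \<and> 1 / a + 1 / b = 1"

definition lr_norm :: "ereal \<Rightarrow> real list \<Rightarrow> real" where
  "lr_norm r xs =
    (if r = \<infinity> then Max (insert 0 (abs ` set xs))
     else (\<Sum>x\<leftarrow>xs. \<bar>x\<bar> powr real_of_ereal r) powr (1 / real_of_ereal r))"

(* Square roots of the eigenvalues of M^T M, with multiplicity; all complex roots of this
   characteristic polynomial are real and nonnegative. If M has more columns than rows, the list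
   contains zeros beyond the usual min(m,n) singular values; they do not affect any l_r norm. *)
definition singular_values :: "real mat \<Rightarrow> real list" where
  "singular_values M =
    map sqrt (sorted_list_of_multiset (proots (char_poly (transpose_mat M * M))))"

definition schatten_norm :: "ereal \<Rightarrow> real mat \<Rightarrow> real" where
  "schatten_norm r M = lr_norm r (singular_values M)"

(* The Jordan_Normal_Form constant orthogonal_mat only asks for pairwise orthogonal nonzero
   columns, so orthonormality is required explicitly here. *)
definition spectral_decomp :: "real mat \<Rightarrow> real mat \<Rightarrow> (nat \<Rightarrow> real) \<Rightarrow> bool" where
  "spectral_decomp A U s \<longleftrightarrow>
    U \<in> carrier_mat (dim_row A) (dim_row A) \<and>
    transpose_mat U * U = 1\<^sub>m (dim_row A) \<and>
    U * transpose_mat U = 1\<^sub>m (dim_row A) \<and>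
    (\<forall>i<dim_row A. 0 \<le> s i) \<and>
    A = U * mat_diag (dim_row A) s * transpose_mat U"

(* Unlike powr, this has 0 to the power 0 equal to 1. *)
definition nonneg_pow :: "real \<Rightarrow> real \<Rightarrow> real" where
  "nonneg_pow x a = (if a = 0 then 1 else x powr a)"

(* For positive semidefinite A and a \<ge> 0; the value does not depend on the decomposition. *)
definition psd_pow_nonneg :: "real mat \<Rightarrow> real \<Rightarrow> real mat" where
  "psd_pow_nonneg A a =
    (THE B. \<exists>U s. spectral_decomp A U s \<and>
       B = U * mat_diag (dim_row A) (\<lambda>i. nonneg_pow (s i) a) * transpose_mat U)"

(* Moore-Penrose pseudoinverse, by the four Penrose conditions. *)
definition is_pinv :: "real mat \<Rightarrow> real mat \<Rightarrow> bool" where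
  "is_pinv A P \<longleftrightarrow>
    P \<in> carrier_mat (dim_col A) (dim_row A) \<and>
    A * P * A = A \<and> P * A * P = P \<and>
    transpose_mat (A * P) = A * P \<and> transpose_mat (P * A) = P * A"

definition pinv :: "real mat \<Rightarrow> real mat" where
  "pinv A = (THE P. is_pinv A P)"

definition psd_pow :: "real mat \<Rightarrow> real \<Rightarrow> real mat" where
  "psd_pow A a = (if 0 \<le> a then psd_pow_nonneg A a else psd_pow_nonneg (pinv A) (- a))"

(* The selected minimizer over the Schatten-p unit ball; it depends on p only through the
   conjugate exponent q, which is the argument here. *)
definition Delta_b :: "real \<Rightarrow> real mat \<Rightarrow> real mat" where
  "Delta_b q M =
    (if M = 0\<^sub>m (dim_row M) (dim_col M) then M
     else (- 1 / schatten_norm (ereal q) M powr (q - 1)) \<cdot>\<^sub>m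
            (M * psd_pow (transpose_mat M * M) ((q - 2) / 2)))"

(* An element of the product of the matrix spaces is represented by a function on nat of which
   only the values on {1..J} matter. *)
definition block_space :: "nat \<Rightarrow> (nat \<Rightarrow> nat) \<Rightarrow> (nat \<Rightarrow> nat) \<Rightarrow> (nat \<Rightarrow> real mat) set" where
  "block_space J m n = {X. \<forall>j\<in>{1..J}. X j \<in> carrier_mat (m j) (n j)}"

definition trace_inner :: "real mat \<Rightarrow> real mat \<Rightarrow> real" where
  "trace_inner A B = (\<Sum>i<dim_col A. (transpose_mat A * B) $$ (i, i))"

definition block_inner :: "nat \<Rightarrow> (nat \<Rightarrow> real mat) \<Rightarrow> (nat \<Rightarrow> real mat) \<Rightarrow> real" where
  "block_inner J X Y = (\<Sum>j\<in>{1..J}. trace_inner (X j) (Y j))"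

definition norm_wp ::
  "nat \<Rightarrow> (nat \<Rightarrow> real) \<Rightarrow> ereal \<Rightarrow> (nat \<Rightarrow> ereal) \<Rightarrow> (nat \<Rightarrow> real mat) \<Rightarrow> real" where
  "norm_wp J L \<alpha> p X =
    lr_norm \<alpha> (map (\<lambda>j. L j powr (1/2) * schatten_norm (p j) (X j)) [1..<Suc J])"

definition norm_vq ::
  "nat \<Rightarrow> (nat \<Rightarrow> real) \<Rightarrow> real \<Rightarrow> (nat \<Rightarrow> real) \<Rightarrow> (nat \<Rightarrow> real mat) \<Rightarrow> real" where
  "norm_vq J L \<beta> q X =
    lr_norm (ereal \<beta>)
      (map (\<lambda>j. L j powr (-1/2) * schatten_norm (ereal (q j)) (X j)) [1..<Suc J])"

(* In the case \<beta> = 1, a zero block has base 0 and exponent 0; the value of that scalar is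
   irrelevant because Delta_b vanishes on the block. *)
definition Z_ball ::
  "nat \<Rightarrow> (nat \<Rightarrow> real) \<Rightarrow> real \<Rightarrow> (nat \<Rightarrow> real) \<Rightarrow> (nat \<Rightarrow> real mat) \<Rightarrow> nat \<Rightarrow> real mat" where
  "Z_ball J L \<beta> q M j =
    (L j powr (-1/2) *
     (L j powr (-1/2) * schatten_norm (ereal (q j)) (M j) / norm_vq J L \<beta> q M) powr (\<beta> - 1))
    \<cdot>\<^sub>m Delta_b (q j) (M j)"

definition Z_reg ::
  "nat \<Rightarrow> (nat \<Rightarrow> real) \<Rightarrow> real \<Rightarrow> (nat \<Rightarrow> real) \<Rightarrow> (nat \<Rightarrow> real mat) \<Rightarrow> nat \<Rightarrow> real mat" where
  "Z_reg J L \<beta> q M j = norm_vq J L \<beta> q M \<cdot>\<^sub>m Z_ball J L \<beta> q M j"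

definition ball_minimizer ::
  "nat \<Rightarrow> (nat \<Rightarrow> nat) \<Rightarrow> (nat \<Rightarrow> nat) \<Rightarrow> (nat \<Rightarrow> real) \<Rightarrow> ereal \<Rightarrow> (nat \<Rightarrow> ereal) \<Rightarrow>
   (nat \<Rightarrow> real mat) \<Rightarrow> (nat \<Rightarrow> real mat) \<Rightarrow> bool" where
  "ball_minimizer J m n L \<alpha> p M Z \<longleftrightarrow>
    is_arg_min (block_inner J M) (\<lambda>Z. Z \<in> block_space J m n \<and> norm_wp J L \<alpha> p Z \<le> 1) Z"

definition reg_minimizer ::
  "nat \<Rightarrow> (nat \<Rightarrow> nat) \<Rightarrow> (nat \<Rightarrow> nat) \<Rightarrow> (nat \<Rightarrow> real) \<Rightarrow> ereal \<Rightarrow> (nat \<Rightarrow> ereal) \<Rightarrow>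
   (nat \<Rightarrow> real mat) \<Rightarrow> (nat \<Rightarrow> real mat) \<Rightarrow> bool" where
  "reg_minimizer J m n L \<alpha> p M Z \<longleftrightarrow>
    is_arg_min (\<lambda>Z. block_inner J M Z + 1/2 * (norm_wp J L \<alpha> p Z)\<^sup>2)
      (\<lambda>Z. Z \<in> block_space J m n) Z"

end

theory Submission
  imports
    Defs
    "HOL-Analysis.Convex"
    "Jordan_Normal_Form.Schur_Decomposition"
    "Jordan_Normal_Form.Spectral_Radius"
begin

text \<open>
  The core is the Hoelder inequality for Schatten norms with \<open>p \<ge> 2\<close>. In an orthonormal eigenbasis
  \<open>v\<^sub>i\<close> of \<open>M\<^sup>T M\<close>, the inner product of \<open>M\<close> and \<open>Z\<close> is the sum of the inner products of \<open>M v\<^sub>i\<close> and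
  \<open>Z v\<^sub>i\<close>, and \<open>M v\<^sub>i\<close> has norm \<open>\<sigma>\<^sub>i\<close>. The squared norm of \<open>Z v\<^sub>i\<close> is an average of the squared singular
  values of \<open>Z\<close> with doubly stochastic weights, so by Jensen's inequality for the exponent \<open>p/2\<close> the
  norms of the \<open>Z v\<^sub>i\<close> have \<open>l\<^sub>p\<close> norm at most that of \<open>Z\<close>. Equality for \<open>\<Delta>\<^sup>b\<close> is a scalar computation in the
  same eigenbasis. Applying the scalar Hoelder inequality once more to the block norms bounds
  the inner product below by \<open>- N \<parallel>Z\<parallel>\<close>, where \<open>N\<close> is the dual norm of \<open>M\<close>; the ball problem then has value
  \<open>-N\<close>, and completing the square gives the value \<open>- N\<^sup>2 / 2\<close> of the regularized one.
\<close>

subsection \<open>Scalar norms\<close>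

text \<open>A real \<beta> makes 1/\<beta> positive, which excludes \<alpha> = 1. What remains is
  the endpoint with \<alpha> infinite, or two finite exponents strictly above 1.\<close>

lemma conjugate_exponents_cases:
  assumes "conjugate_exponents \<alpha> (ereal \<beta>)"
  obtains "\<alpha> = \<infinity>" "\<beta> = 1"
    | a where "\<alpha> = ereal a" "1 < a" "1 < \<beta>" "1 / a + 1 / \<beta> = 1"
proof (cases \<alpha>)
  case (real a)
  then have "1 \<le> a" "1 \<le> \<beta>" "1 / a + 1 / \<beta> = 1"
    using assms by (auto simp: conjugate_exponents_def one_ereal_def)
  moreover from this have "a \<noteq> 1" "\<beta> \<noteq> 1" by auto
  ultimately show thesis using that(2)[OF real] by auto
next
  case PInf
  then have "1 \<le> \<beta>" "1 / \<beta> = 1"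
    using assms by (auto simp: conjugate_exponents_def one_ereal_def)
  then show thesis using that(1)[OF PInf] by auto
next
  case MInf
  then show thesis using assms by (simp add: conjugate_exponents_def)
qed

text \<open>Allows the singular values to be listed in the order of an eigenbasis instead of the
  sorted order of \<open>singular_values\<close>.\<close>

lemma lr_norm_mset_cong:
  assumes "mset xs = mset ys" shows "lr_norm r xs = lr_norm r ys"
proof -
  have "sum_list (map f xs) = sum_list (map f ys)" for f :: "real \<Rightarrow> real"
    using assms by (metis mset_map sum_mset_sum_list)
  then show ?thesis using mset_eq_setD[OF assms] unfolding lr_norm_def by presburger
qed

lemma lr_norm_real_map:
  assumes "distinct xs"
  shows "lr_norm (ereal r) (map f xs) = (\<Sum>i\<in>set xs. \<bar>f i\<bar> powr r) powr (1 / r)"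
  using assms by (simp add: lr_norm_def o_def sum_list_distinct_conv_sum_set)

text \<open>The conjunct \<open>0 \<le> c\<close> comes from the 0 inserted into the maximum; it
  matters for empty lists.\<close>

lemma lr_norm_infinity_le_iff:
  "lr_norm \<infinity> (map f xs) \<le> c \<longleftrightarrow> 0 \<le> c \<and> (\<forall>i\<in>set xs. \<bar>f i\<bar> \<le> c)"
  by (auto simp: lr_norm_def)

lemma lr_norm_nonneg [simp]: "0 \<le> lr_norm r xs"
  by (auto simp: lr_norm_def)

lemma lr_norm_scale: "1 \<le> r \<Longrightarrow> lr_norm r (map (\<lambda>i. c * f i) xs) = \<bar>c\<bar> * lr_norm r (map f xs)"
proof (cases r)
  case (real a)
  assume "1 \<le> r"
  then have "1 \<le> a" using real by simp
  then show ?thesis using real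
    by (simp add: lr_norm_def o_def abs_mult powr_mult sum_list_const_mult powr_powr sum_list_nonneg)
next
  case PInf
  \<comment> \<open>One inequality for arbitrary \<open>c\<close> and \<open>f\<close> suffices: for
    nonzero \<open>c\<close> the converse is the same bound with factor \<open>1 / c\<close> applied
    to the scaled function.\<close>
  have *: "lr_norm \<infinity> (map (\<lambda>i. c * f i) xs) \<le> \<bar>c\<bar> * lr_norm \<infinity> (map f xs)" for c f
  proof -
    have "\<bar>f i\<bar> \<le> lr_norm \<infinity> (map f xs)" if "i \<in> set xs" for i
      using lr_norm_infinity_le_iff[of f xs "lr_norm \<infinity> (map f xs)"] that by blast
    then show ?thesis by (simp add: lr_norm_infinity_le_iff abs_mult mult_left_mono)
  qed
  have "\<bar>c\<bar> * lr_norm \<infinity> (map f xs) \<le> lr_norm \<infinity> (map (\<lambda>i. c * f i) xs)"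
  proof (cases "c = 0")
    case False
    then show ?thesis using *[of "1 / c" "\<lambda>i. c * f i"] by (simp add: field_simps)
  qed simp
  then show ?thesis using *[of c f] PInf by simp
qed auto

lemma lr_norm_eq_0_iff:
  assumes "1 \<le> r" shows "lr_norm r xs = 0 \<longleftrightarrow> (\<forall>x\<in>set xs. x = 0)"
proof (cases r)
  case (real a)
  then have "1 \<le> a" using assms by simp
  have "(\<Sum>x\<leftarrow>xs. \<bar>x\<bar> powr a) = 0 \<longleftrightarrow> (\<forall>x\<in>set xs. x = 0)"
    by (subst sum_list_nonneg_eq_0_iff) auto
  then show ?thesis using real by (simp add: lr_norm_def)
next
  case PInf
  have "lr_norm r xs \<le> 0 \<longleftrightarrow> (\<forall>x\<in>set xs. x = 0)"
    using lr_norm_infinity_le_iff[of "\<lambda>x. x" xs 0] PInf by simp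
  then show ?thesis using lr_norm_nonneg[of r xs] by (metis order.antisym order.refl)
qed (use assms in auto)

text \<open>At the endpoint each factor of \<open>g\<close> is bounded by the maximum. For finite
  exponents both vectors are normalized, Young's inequality is applied to each term, and the two
  resulting sums add up to 1/\<beta> + 1/a = 1.\<close>

lemma lr_norm_Hoelder:
  assumes conj: "conjugate_exponents \<alpha> (ereal \<beta>)" and "distinct xs"
  shows "(\<Sum>i\<in>set xs. \<bar>f i\<bar> * \<bar>g i\<bar>) \<le> lr_norm (ereal \<beta>) (map f xs) * lr_norm \<alpha> (map g xs)"
  using conj
proof (cases rule: conjugate_exponents_cases)
  case 1
  have "\<bar>g i\<bar> \<le> lr_norm \<infinity> (map g xs)" if "i \<in> set xs" for i
    using lr_norm_infinity_le_iff[of g xs "lr_norm \<infinity> (map g xs)"] that by blast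
  then have "(\<Sum>i\<in>set xs. \<bar>f i\<bar> * \<bar>g i\<bar>) \<le> (\<Sum>i\<in>set xs. \<bar>f i\<bar> * lr_norm \<infinity> (map g xs))"
    by (intro sum_mono mult_left_mono) auto
  then show ?thesis using 1 assms(2)
    by (simp add: lr_norm_real_map sum_nonneg flip: sum_distrib_right)
next
  case (2 a)
  define F where "F = lr_norm (ereal \<beta>) (map f xs)"
  define G where "G = lr_norm (ereal a) (map g xs)"
  show ?thesis
  proof (cases "F = 0 \<or> G = 0")
    case True
    then have "\<forall>i\<in>set xs. \<bar>f i\<bar> * \<bar>g i\<bar> = 0"
      using lr_norm_eq_0_iff[of "ereal \<beta>" "map f xs"] lr_norm_eq_0_iff[of "ereal a" "map g xs"] 2
      by (auto simp: F_def G_def)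
    then have "(\<Sum>i\<in>set xs. \<bar>f i\<bar> * \<bar>g i\<bar>) = 0" by (intro sum.neutral)
    then show ?thesis by simp
  next
    case False
    then have pos: "0 < F" "0 < G" using lr_norm_nonneg unfolding F_def G_def by (metis less_eq_real_def)+
    have Fp: "F powr \<beta> = (\<Sum>i\<in>set xs. \<bar>f i\<bar> powr \<beta>)"
      using 2 assms by (simp add: F_def lr_norm_real_map powr_powr sum_nonneg)
    have Gp: "G powr a = (\<Sum>i\<in>set xs. \<bar>g i\<bar> powr a)"
      using 2 assms by (simp add: G_def lr_norm_real_map powr_powr sum_nonneg)
    have "(\<Sum>i\<in>set xs. (\<bar>f i\<bar> / F) * (\<bar>g i\<bar> / G))
        \<le> (\<Sum>i\<in>set xs. (\<bar>f i\<bar> / F) powr \<beta> / \<beta> + (\<bar>g i\<bar> / G) powr a / a)"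
      using 2 pos by (intro sum_mono Youngs_inequality) auto
    also have "\<dots> = (\<Sum>i\<in>set xs. \<bar>f i\<bar> powr \<beta>) / F powr \<beta> / \<beta> + (\<Sum>i\<in>set xs. \<bar>g i\<bar> powr a) / G powr a / a"
      using pos by (simp add: sum.distrib powr_divide sum_divide_distrib)
    also have "\<dots> = 1" using pos 2 by (simp flip: Fp Gp)
    finally have "(\<Sum>i\<in>set xs. \<bar>f i\<bar> * \<bar>g i\<bar>) / (F * G) \<le> 1"
      by (simp add: sum_divide_distrib)
    then show ?thesis using pos 2 by (simp add: F_def G_def field_simps)
  qed
qed

text \<open>Conjugacy gives (\<beta> - 1) a = \<beta>, so the a-th powers of the bounds sum to one.
  Only an upper bound on \<open>g\<close> is assumed because the block version knows merely that
  each \<open>Delta_b\<close> lies in its unit ball.\<close>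

lemma lr_norm_dual_vector_le:
  assumes conj: "conjugate_exponents \<alpha> (ereal \<beta>)" and "distinct xs"
    and N: "N = lr_norm (ereal \<beta>) (map f xs)" "0 < N"
    and g: "\<And>i. i \<in> set xs \<Longrightarrow> \<bar>g i\<bar> \<le> (\<bar>f i\<bar> / N) powr (\<beta> - 1)"
  shows "lr_norm \<alpha> (map g xs) \<le> 1"
  using conj
proof (cases rule: conjugate_exponents_cases)
  case 1
  \<comment> \<open>The exponent is now 0, and \<open>x powr 0\<close> is 0 for x = 0 and 1
    otherwise.\<close>
  have "\<bar>g i\<bar> \<le> 1" if "i \<in> set xs" for i
    using g[OF that] 1 by (auto split: if_splits)
  then show ?thesis using 1 by (simp add: lr_norm_infinity_le_iff)
next
  case (2 a)
  have exps: "(\<beta> - 1) * a = \<beta>" using 2 by (simp add: field_simps)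
  have Np: "N powr \<beta> = (\<Sum>i\<in>set xs. \<bar>f i\<bar> powr \<beta>)"
    using 2 assms by (simp add: lr_norm_real_map powr_powr sum_nonneg)
  have "(\<Sum>i\<in>set xs. \<bar>g i\<bar> powr a) \<le> (\<Sum>i\<in>set xs. ((\<bar>f i\<bar> / N) powr (\<beta> - 1)) powr a)"
    using 2 g by (intro sum_mono powr_mono2) auto
  also have "\<dots> = (\<Sum>i\<in>set xs. \<bar>f i\<bar> powr \<beta>) / N powr \<beta>"
    using N by (simp add: powr_powr exps powr_divide sum_divide_distrib)
  also have "\<dots> = 1" using N(2) by (simp flip: Np)
  finally show ?thesis using 2 assms(2) 
    by (simp add: lr_norm_real_map powr_le_one_le sum_nonneg powr_le1)
qed

text \<open>The equality case of Hoelder: each term is |f i|^\<beta> / N^(\<beta> - 1), and the sum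
  of the |f i|^\<beta> is N^\<beta>.\<close>

lemma sum_dual_vector:
  assumes "1 \<le> \<beta>" "distinct xs"
    and N: "N = lr_norm (ereal \<beta>) (map f xs)" "0 < N"
  shows "(\<Sum>i\<in>set xs. \<bar>f i\<bar> * (\<bar>f i\<bar> / N) powr (\<beta> - 1)) = N"
proof -
  have Np: "N powr \<beta> = (\<Sum>i\<in>set xs. \<bar>f i\<bar> powr \<beta>)"
    using assms by (simp add: lr_norm_real_map powr_powr sum_nonneg)
  have "\<bar>f i\<bar> * (\<bar>f i\<bar> / N) powr (\<beta> - 1) = \<bar>f i\<bar> powr \<beta> / N powr (\<beta> - 1)" for i
    using N(2) by (simp add: powr_divide powr_mult_base)
  then have "(\<Sum>i\<in>set xs. \<bar>f i\<bar> * (\<bar>f i\<bar> / N) powr (\<beta> - 1)) = N powr \<beta> / N powr (\<beta> - 1)"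
    by (simp add: Np sum_divide_distrib)
  also have "\<dots> = N" using N(2) by (simp flip: powr_diff)
  finally show ?thesis .
qed

text \<open>After division by the mean \<mu>, average the tangent line inequality of x^r at x = 1
  over the weights; the linear side averages to 1.\<close>

lemma powr_Jensen:
  fixes w t :: "'a \<Rightarrow> real"
  assumes r: "1 \<le> r" and w: "\<And>k. k \<in> S \<Longrightarrow> 0 \<le> w k" "sum w S = 1"
    and t: "\<And>k. k \<in> S \<Longrightarrow> 0 \<le> t k"
  shows "(\<Sum>k\<in>S. w k * t k) powr r \<le> (\<Sum>k\<in>S. w k * t k powr r)"
proof -
  define \<mu> where "\<mu> = (\<Sum>k\<in>S. w k * t k)"
  have "0 \<le> \<mu>" unfolding \<mu>_def using w t by (intro sum_nonneg) auto
  show ?thesis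
  proof (cases "\<mu> = 0")
    case True
    then show ?thesis using w t by (auto simp: \<mu>_def intro!: sum_nonneg)
  next
    case False
    then have pos: "0 < \<mu>" using \<open>0 \<le> \<mu>\<close> by simp
    \<comment> \<open>Weighted arithmetic-geometric mean of x^r and 1 with weights 1/r and 1 -
      1/r.\<close>
    have tangent: "x \<le> x powr r / r + (1 - 1 / r)" if "0 \<le> x" for x :: real
    proof (cases "x = 0")
      case False
      then show ?thesis
        using Youngs_inequality_0[of "1 / r" "1 - 1 / r" "x powr r" 1] that r
        by (simp add: powr_powr)
    qed (use r in auto)
    have "\<mu> / \<mu> = (\<Sum>k\<in>S. w k * (t k / \<mu>))" by (simp add: \<mu>_def flip: sum_divide_distrib)
    also have "\<dots> \<le> (\<Sum>k\<in>S. w k * ((t k / \<mu>) powr r / r + (1 - 1 / r)))"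
      using w t pos by (intro sum_mono mult_left_mono tangent) auto
    also have "\<dots> = (\<Sum>k\<in>S. w k * t k powr r / (\<mu> powr r * r) + w k * (1 - 1 / r))"
      using pos by (intro sum.cong refl) (simp add: powr_divide ring_distribs)
    also have "\<dots> = (\<Sum>k\<in>S. w k * t k powr r) / (\<mu> powr r * r) + (1 - 1 / r)"
      using w(2) by (simp add: sum.distrib sum_divide_distrib flip: sum_distrib_right)
    finally have "1 / r \<le> (\<Sum>k\<in>S. w k * t k powr r) / (\<mu> powr r * r)" using pos by simp
    then show ?thesis unfolding \<mu>_def[symmetric] using pos r by (simp add: field_simps)
  qed
qed

subsection \<open>The spectral theorem for real symmetric matrices\<close>

text \<open>Rewriting to right-associated products with a single dimension to instantiate.\<close>

lemma square_mult:
  fixes A :: "real mat"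
  assumes "A \<in> carrier_mat n n" "B \<in> carrier_mat n n"
  shows "A * B \<in> carrier_mat n n" "C \<in> carrier_mat n n \<Longrightarrow> A * B * C = A * (B * C)"
  using assms by auto


text \<open>A complex eigenvector x + iy always exists. Symmetry forces its eigenvalue to be real,
  so x and y both satisfy the real eigenvector equation, and at least one of them is
  nonzero.\<close>

lemma symmetric_real_eigenvector:
  fixes A :: "real mat"
  assumes A: "A \<in> carrier_mat n n" and sym: "transpose_mat A = A" and n: "0 < n"
  obtains v e where "v \<in> carrier_vec n" "v \<noteq> 0\<^sub>v n" "A *\<^sub>v v = e \<cdot>\<^sub>v v"
proof -
  define C where "C = map_mat complex_of_real A"
  have C: "C \<in> carrier_mat n n" using A by (simp add: C_def)
  from spectrum_non_empty[OF C n] obtain k z where "eigenvector C z k"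
    by (auto simp: spectrum_def eigenvalue_def)
  then have z: "z \<in> carrier_vec n" "z \<noteq> 0\<^sub>v n" and ev: "C *\<^sub>v z = k \<cdot>\<^sub>v z"
    using C by (auto simp: eigenvector_def)
  define x y where "x = map_vec Re z" and "y = map_vec Im z"
  have xy: "x \<in> carrier_vec n" "y \<in> carrier_vec n" using z by (auto simp: x_def y_def)
  have ev_i: "(\<Sum>j<n. complex_of_real (A $$ (i, j)) * z $ j) = k * z $ i" if "i < n" for i
  proof -
    have "(C *\<^sub>v z) $ i = (\<Sum>j<n. complex_of_real (A $$ (i, j)) * z $ j)"
      using A z that by (simp add: C_def scalar_prod_def lessThan_atLeast0)
    then show ?thesis using ev z that by simp
  qed
  have Ax: "(\<Sum>j<n. A $$ (i, j) * x $ j) = Re k * x $ i - Im k * y $ i" if "i < n" for i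
    using arg_cong[OF ev_i[OF that], of Re] z that by (simp add: Re_sum x_def y_def)
  have Ay: "(\<Sum>j<n. A $$ (i, j) * y $ j) = Im k * x $ i + Re k * y $ i" if "i < n" for i
    using arg_cong[OF ev_i[OF that], of Im] z that by (simp add: Im_sum x_def y_def add.commute)
  have sym_ij: "A $$ (i, j) = A $$ (j, i)" if "i < n" "j < n" for i j
    using arg_cong[OF sym, of "\<lambda>B. B $$ (i, j)"] A that by simp
  \<comment> \<open>The number y^T A x equals x^T A y; evaluating both by the eigenvalue equations
    leaves Im k times the squared length of z.\<close>
  have "(\<Sum>i<n. y $ i * (Re k * x $ i - Im k * y $ i)) = (\<Sum>i<n. \<Sum>j<n. y $ i * A $$ (i, j) * x $ j)"
    by (simp add: Ax[symmetric] sum_distrib_left mult.assoc)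
  also have "\<dots> = (\<Sum>j<n. \<Sum>i<n. y $ i * A $$ (i, j) * x $ j)" by (rule sum.swap)
  also have "\<dots> = (\<Sum>j<n. x $ j * (Im k * x $ j + Re k * y $ j))"
    by (simp add: Ay[symmetric] sum_distrib_left sym_ij mult.assoc mult.commute mult.left_commute)
  finally have "Im k * (\<Sum>i<n. (x $ i)\<^sup>2 + (y $ i)\<^sup>2) = 0"
    by (simp add: algebra_simps power2_eq_square sum.distrib sum_subtractf sum_distrib_left)
  moreover have "(\<Sum>i<n. (x $ i)\<^sup>2 + (y $ i)\<^sup>2) \<noteq> 0"
  proof
    assume "(\<Sum>i<n. (x $ i)\<^sup>2 + (y $ i)\<^sup>2) = 0"
    then have "\<forall>i<n. (x $ i)\<^sup>2 + (y $ i)\<^sup>2 = 0" by (subst (asm) sum_nonneg_eq_0_iff) auto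
    then have "z = 0\<^sub>v n" using z by (auto intro!: eq_vecI complex_eqI simp: x_def y_def)
    then show False using z by simp
  qed
  ultimately have "Im k = 0" by simp
  then have "A *\<^sub>v x = Re k \<cdot>\<^sub>v x" "A *\<^sub>v y = Re k \<cdot>\<^sub>v y"
    using A xy Ax Ay by (auto intro!: eq_vecI simp: scalar_prod_def lessThan_atLeast0)
  moreover have "x \<noteq> 0\<^sub>v n \<or> y \<noteq> 0\<^sub>v n"
  proof (rule ccontr)
    assume "\<not> ?thesis"
    then have "x $ i = 0 \<and> y $ i = 0" if "i < n" for i using that by simp
    then have "z = 0\<^sub>v n" using z by (auto intro!: eq_vecI complex_eqI simp: x_def y_def)
    then show False using z by simp
  qed
  ultimately show thesis using that xy by blast
qed

section \<open>Orthonormal matrices and diagonalization\<close>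

definition orthonormal_mat :: "nat \<Rightarrow> real mat \<Rightarrow> bool" where
  "orthonormal_mat n U \<longleftrightarrow>
    U \<in> carrier_mat n n \<and> transpose_mat U * U = 1\<^sub>m n \<and> U * transpose_mat U = 1\<^sub>m n"

lemma orthonormal_matI:
  assumes "U \<in> carrier_mat n n" "transpose_mat U * U = 1\<^sub>m n"
  shows "orthonormal_mat n U"
  using assms mat_mult_left_right_inverse[of "transpose_mat U" n U] by (simp add: orthonormal_mat_def)

lemma orthonormal_mat_mult:
  assumes U: "orthonormal_mat n U" and V: "orthonormal_mat n V"
  shows "orthonormal_mat n (U * V)"
proof (rule orthonormal_matI)
  have c: "U \<in> carrier_mat n n" "V \<in> carrier_mat n n"
    using U V by (auto simp: orthonormal_mat_def)
  then show "U * V \<in> carrier_mat n n" by simp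
  have "transpose_mat (U * V) * (U * V) = transpose_mat V * ((transpose_mat U * U) * V)"
    using c by (simp add: transpose_mult[of _ n n _ n] square_mult[of _ n])
  also have "\<dots> = 1\<^sub>m n" using U V c by (simp add: orthonormal_mat_def)
  finally show "transpose_mat (U * V) * (U * V) = 1\<^sub>m n" .
qed

lemma orthonormal_mat_transpose: "orthonormal_mat n U \<Longrightarrow> orthonormal_mat n (transpose_mat U)"
  by (auto simp: orthonormal_mat_def)

text \<open>Complete \<open>v\<close> to a basis that starts with \<open>v\<close>, orthogonalize by
  Gram-Schmidt, and normalize the columns. Gram-Schmidt keeps the first vector, so column 0 is a
  multiple of \<open>v\<close>.\<close>

lemma orthonormal_completion:
  fixes v :: "real vec"
  assumes v: "v \<in> carrier_vec n" "v \<noteq> 0\<^sub>v n"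
  obtains W c where "orthonormal_mat n W" "col W 0 = c \<cdot>\<^sub>v v"
proof -
  interpret cof_vec_space n "TYPE(real)" .
  define b where "b = basis_completion v"
  define ws where "ws = gram_schmidt n b"
  note bc = basis_completion[OF v, folded b_def]
  have n: "0 < n" using v by (cases n) auto
  obtain vs where b: "b = v # vs" using bc(6,7) n by (cases b) auto
  have ws: "set ws \<subseteq> carrier_vec n" "corthogonal ws" "length ws = n"
    using gram_schmidt_result[OF bc(2,4,5) refl, folded ws_def] bc(6) by auto
  have hd: "ws ! 0 = v" using gram_schmidt_hd[OF v(1), of vs, folded b, folded ws_def] ws(3) n
    by (cases ws) auto
  have wsc: "ws ! i \<in> carrier_vec n" if "i < n" for i using ws that by auto
  \<comment> \<open>Conjugation is trivial over the reals. The equivalence also gives nonzero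
    squared lengths, so dividing by \<open>r\<close> is safe.\<close>
  have orth: "scalar_prod (ws ! i) (ws ! j) = 0 \<longleftrightarrow> i \<noteq> j" if "i < n" "j < n" for i j
    using corthogonalD[OF ws(2), of i j] ws(3) that by simp
  define r where "r i = sqrt (scalar_prod (ws ! i) (ws ! i))" for i
  have r: "r i * r i = scalar_prod (ws ! i) (ws ! i)" "r i \<noteq> 0" if "i < n" for i
    using orth[OF that that] by (auto simp: r_def scalar_prod_def sum_nonneg)
  define W where "W = mat n n (\<lambda>(i, j). 1 / r j * (ws ! j) $ i)"
  have W: "W \<in> carrier_mat n n" by (simp add: W_def)
  have colW: "col W j = (1 / r j) \<cdot>\<^sub>v (ws ! j)" if "j < n" for j
    using that wsc[OF that] by (auto simp: W_def intro!: eq_vecI)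
  have "(transpose_mat W * W) $$ (i, j) = 1\<^sub>m n $$ (i, j)" if ij: "i < n" "j < n" for i j
  proof -
    have "(transpose_mat W * W) $$ (i, j) = scalar_prod (col W i) (col W j)"
      using W ij by simp
    also have "\<dots> = scalar_prod (ws ! i) (ws ! j) / (r i * r j)"
      using ij wsc[OF ij(1)] wsc[OF ij(2)] by (simp add: colW)
    also have "\<dots> = 1\<^sub>m n $$ (i, j)"
      using orth[OF ij] r[OF ij(1)] ij by auto
    finally show ?thesis .
  qed
  then have "transpose_mat W * W = 1\<^sub>m n" using W by (intro eq_matI) auto
  then show thesis using that orthonormal_matI[OF W] colW[OF n] hd by metis
qed

text \<open>Deflation: conjugate by an orthonormal matrix whose first column is an eigenvector. The
  first column of the result is then \<open>e\<close> times a unit vector, symmetry clears the first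
  row as well, and the induction hypothesis diagonalizes the remaining block.\<close>

lemma spectral_theorem:
  fixes A :: "real mat"
  assumes "A \<in> carrier_mat n n" "transpose_mat A = A"
  shows "\<exists>U s. orthonormal_mat n U \<and> A = U * mat_diag n s * transpose_mat U"
  using assms
proof (induction n arbitrary: A)
  case 0
  then show ?case
    by (intro exI[of _ "1\<^sub>m 0"] exI[of _ undefined]) (auto simp: orthonormal_mat_def intro!: eq_matI)
next
  case (Suc n A)
  note A = Suc.prems(1)
  obtain v e where v: "v \<in> carrier_vec (Suc n)" "v \<noteq> 0\<^sub>v (Suc n)" "A *\<^sub>v v = e \<cdot>\<^sub>v v"
    using symmetric_real_eigenvector[OF Suc.prems] by blast
  obtain W c where W: "orthonormal_mat (Suc n) W" and W0: "col W 0 = c \<cdot>\<^sub>v v"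
    using orthonormal_completion[OF v(1,2)] by blast
  have Wc: "W \<in> carrier_mat (Suc n) (Suc n)" using W by (simp add: orthonormal_mat_def)
  define A' where "A' = transpose_mat W * A * W"
  have A': "A' \<in> carrier_mat (Suc n) (Suc n)" using A Wc by (simp add: A'_def)
  have symA': "transpose_mat A' = A'"
    using A Wc Suc.prems(2) unfolding A'_def
    by (simp add: transpose_mult[of _ "Suc n" "Suc n" _ "Suc n"])
  have A'0: "A' $$ (i, 0) = (if i = 0 then e else 0)" if i: "i < Suc n" for i
  proof -
    have "A *\<^sub>v col W 0 = e \<cdot>\<^sub>v col W 0"
      unfolding W0 using v A by (simp add: mult_mat_vec[of _ "Suc n" "Suc n"] smult_smult_assoc mult.commute)
    then have "col A' 0 = transpose_mat W *\<^sub>v (e \<cdot>\<^sub>v col W 0)"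
      using A Wc unfolding A'_def
      by (simp add: assoc_mult_mat_vec[of _ "Suc n" "Suc n" _ "Suc n"]
          col_mult2[of _ "Suc n" "Suc n" _ "Suc n"] del: col_mult)
    also have "\<dots> = e \<cdot>\<^sub>v (transpose_mat W *\<^sub>v col W 0)"
      using Wc by (intro mult_mat_vec[of _ "Suc n" "Suc n"]) (auto intro!: carrier_vecI)
    also have "transpose_mat W *\<^sub>v col W 0 = col (transpose_mat W * W) 0"
      using Wc by (subst col_mult2[of _ "Suc n" "Suc n" _ "Suc n"]) auto
    also have "\<dots> = unit_vec (Suc n) 0" using W by (simp add: orthonormal_mat_def)
    finally have "col A' 0 $ i = (e \<cdot>\<^sub>v unit_vec (Suc n) 0) $ i" by simp
    then show ?thesis using i A' by auto
  qed
  have A'0': "A' $$ (0, i) = (if i = 0 then e else 0)" if i: "i < Suc n" for i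
    using A'0[OF i] arg_cong[OF symA', of "\<lambda>B. B $$ (0, i)"] A' i by simp
  define B where "B = mat n n (\<lambda>(i, j). A' $$ (Suc i, Suc j))"
  have B: "B \<in> carrier_mat n n" by (simp add: B_def)
  have "transpose_mat B = B"
  proof (rule eq_matI)
    fix i j assume "i < dim_row B" "j < dim_col B"
    then show "transpose_mat B $$ (i, j) = B $$ (i, j)"
      using arg_cong[OF symA', of "\<lambda>B. B $$ (Suc i, Suc j)"] A' by (simp add: B_def)
  qed (auto simp: B_def)
  from Suc.IH[OF B this] obtain V t where V: "orthonormal_mat n V"
    and BV: "B = V * mat_diag n t * transpose_mat V" by blast
  have Vc: "V \<in> carrier_mat n n" using V by (simp add: orthonormal_mat_def)
  \<comment> \<open>The split-off eigenvalue \<open>e\<close> gets index 0 and those of the smaller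
    block are shifted by one, matching the block form of \<open>V'\<close>.\<close>
  define s where "s i = (case i of 0 \<Rightarrow> e | Suc k \<Rightarrow> t k)" for i
  define V' where "V' = four_block_mat (1\<^sub>m 1) (0\<^sub>m 1 n) (0\<^sub>m n 1) V"
  have V'c: "V' \<in> carrier_mat (Suc n) (Suc n)"
    using Vc four_block_carrier_mat[of "1\<^sub>m 1" 1 1 V n n] by (simp add: V'_def)
  have V't: "transpose_mat V' = four_block_mat (1\<^sub>m 1) (0\<^sub>m 1 n) (0\<^sub>m n 1) (transpose_mat V)"
    using Vc by (simp add: V'_def transpose_four_block_mat[of _ 1 1 _ n _ n])
  have D: "mat_diag (Suc n) s = four_block_mat (mat 1 1 (\<lambda>_. e)) (0\<^sub>m 1 n) (0\<^sub>m n 1) (mat_diag n t)"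
    by (rule eq_matI) (auto simp: mat_diag_def s_def split: nat.splits)
  have "transpose_mat V' * V' = 1\<^sub>m (Suc n)"
    unfolding V't unfolding V'_def using V Vc
    by (simp add: mult_four_block_mat[of _ 1 1 _ n _ n _ _ 1 _ n] orthonormal_mat_def)
  then have V'o: "orthonormal_mat (Suc n) V'" by (rule orthonormal_matI[OF V'c])
  have "A' = four_block_mat (mat 1 1 (\<lambda>_. e)) (0\<^sub>m 1 n) (0\<^sub>m n 1) B"
  proof (rule eq_matI)
    fix i j
    assume "i < dim_row (four_block_mat (mat 1 1 (\<lambda>_. e)) (0\<^sub>m 1 n) (0\<^sub>m n 1) B)"
      "j < dim_col (four_block_mat (mat 1 1 (\<lambda>_. e)) (0\<^sub>m 1 n) (0\<^sub>m n 1) B)"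
    then have "i < Suc n" "j < Suc n" by (auto simp: B_def)
    then show "A' $$ (i, j) = four_block_mat (mat 1 1 (\<lambda>_. e)) (0\<^sub>m 1 n) (0\<^sub>m n 1) B $$ (i, j)"
      using A'0[of i] A'0'[of j] by (cases i; cases j) (auto simp: B_def)
  qed (use A' in \<open>auto simp: B_def\<close>)
  also have "\<dots> = V' * mat_diag (Suc n) s * transpose_mat V'"
    unfolding V't D BV unfolding V'_def using Vc
    by (simp add: mult_four_block_mat[of _ 1 1 _ n _ n _ _ 1 _ n] square_mult[of _ n]
        left_mult_zero_mat[OF mat_diag_dim] right_mult_zero_mat[of _ n n])
  finally have A'V': "A' = V' * mat_diag (Suc n) s * transpose_mat V'" .
  have WW: "W * transpose_mat W = 1\<^sub>m (Suc n)" using W by (simp add: orthonormal_mat_def)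
  have "W * A' * transpose_mat W = (W * transpose_mat W) * A * (W * transpose_mat W)"
    using A Wc unfolding A'_def by (simp add: square_mult[of _ "Suc n"])
  then have "A = W * A' * transpose_mat W" unfolding WW using A by simp
  also have "\<dots> = (W * V') * mat_diag (Suc n) s * transpose_mat (W * V')"
    unfolding A'V' using Wc V'c
    by (simp add: transpose_mult[of _ "Suc n" "Suc n" _ "Suc n"] square_mult[of _ "Suc n"])
  finally show ?case using orthonormal_mat_mult[OF W V'o] by blast
qed

subsection \<open>Functions of a symmetric matrix\<close>

lemma spectral_decomp_alt:
  assumes "A \<in> carrier_mat n n"
  shows "spectral_decomp A U s \<longleftrightarrow>
    orthonormal_mat n U \<and> (\<forall>i<n. 0 \<le> s i) \<and> A = U * mat_diag n s * transpose_mat U"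
  using assms by (auto simp: spectral_decomp_def orthonormal_mat_def)

lemma orthonormal_mat_cancel:
  assumes "orthonormal_mat n U" "X \<in> carrier_mat n k"
  shows "transpose_mat U * (U * X) = X" "U * (transpose_mat U * X) = X"
  using assms by (auto simp: orthonormal_mat_def simp flip: assoc_mult_mat[of _ n n _ n _ k])

text \<open>With the eigenbasis fixed, products, pseudoinverses and powers become entrywise
  operations on \<open>s\<close>.\<close>

definition spectral_fun :: "nat \<Rightarrow> real mat \<Rightarrow> (nat \<Rightarrow> real) \<Rightarrow> real mat" where
  "spectral_fun n U s = U * mat_diag n s * transpose_mat U"

lemma spectral_fun_carrier [simp]: "orthonormal_mat n U \<Longrightarrow> spectral_fun n U s \<in> carrier_mat n n"
  by (simp add: spectral_fun_def orthonormal_mat_def square_mult[of _ n])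

lemma spectral_fun_mult:
  assumes U: "orthonormal_mat n U"
  shows "spectral_fun n U s * spectral_fun n U t = spectral_fun n U (\<lambda>i. s i * t i)"
proof -
  have c: "U \<in> carrier_mat n n" using U by (simp add: orthonormal_mat_def)
  have "spectral_fun n U s * spectral_fun n U t
      = U * (mat_diag n s * (transpose_mat U * (U * (mat_diag n t * transpose_mat U))))"
    using c by (simp add: spectral_fun_def square_mult[of _ n])
  also have "\<dots> = U * ((mat_diag n s * mat_diag n t) * transpose_mat U)"
    using c by (simp add: orthonormal_mat_cancel(1)[OF U, of _ n] square_mult[of _ n] del: mat_diag_diag)
  also have "\<dots> = spectral_fun n U (\<lambda>i. s i * t i)"
    using c by (simp add: spectral_fun_def square_mult[of _ n])
  finally show ?thesis .
qed

lemma transpose_mat_diag: "transpose_mat (mat_diag n s) = mat_diag n s"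
  by (rule eq_matI) (auto simp: mat_diag_def)

lemma spectral_fun_transpose:
  assumes "orthonormal_mat n U"
  shows "transpose_mat (spectral_fun n U s) = spectral_fun n U s"
  using assms unfolding spectral_fun_def orthonormal_mat_def
  by (simp add: transpose_mult[of _ n n _ n] transpose_mat_diag square_mult[of _ n])

lemma mat_diag_cong: "(\<And>i. i < n \<Longrightarrow> s i = t i) \<Longrightarrow> mat_diag n s = mat_diag n t"
  by (rule eq_matI) (auto simp: mat_diag_def)

lemma spectral_fun_cong:
  "(\<And>i. i < n \<Longrightarrow> s i = t i) \<Longrightarrow> spectral_fun n U s = spectral_fun n U t"
  unfolding spectral_fun_def using mat_diag_cong[of n s t] by simp

text \<open>The matrix W = V^T U intertwines the two diagonal matrices: t_i W_ij = W_ij s_j. So W_ij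
  can be nonzero only where t_i = s_j, and there f(t_i) = f(s_j); hence W also intertwines the
  diagonals after applying f.\<close>

lemma spectral_fun_unique:
  assumes U: "orthonormal_mat n U" and V: "orthonormal_mat n V"
    and eq: "spectral_fun n U s = spectral_fun n V t"
  shows "spectral_fun n U (\<lambda>i. f (s i)) = spectral_fun n V (\<lambda>i. f (t i))"
proof -
  have c: "U \<in> carrier_mat n n" "V \<in> carrier_mat n n"
    using U V by (auto simp: orthonormal_mat_def)
  define W where "W = transpose_mat V * U"
  have W: "W \<in> carrier_mat n n" using c by (simp add: W_def)
  have "transpose_mat V * (spectral_fun n U s * U) = W * mat_diag n s"
    using U c by (simp add: spectral_fun_def W_def square_mult[of _ n] orthonormal_mat_def
        right_mult_one_mat[OF mat_diag_dim])
  moreover have "transpose_mat V * (spectral_fun n V t * U) = mat_diag n t * W"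
    using c by (simp add: spectral_fun_def W_def square_mult[of _ n]
        orthonormal_mat_cancel(1)[OF V, of _ n])
  ultimately have "mat_diag n t * W = W * mat_diag n s" using eq by simp
  note entries = this[unfolded mat_diag_mult_left[OF W] mat_diag_mult_right[OF W]]
  have eq_ij: "t i * W $$ (i, j) = W $$ (i, j) * s j" if "i < n" "j < n" for i j
    using arg_cong[OF entries, of "\<lambda>A. A $$ (i, j)"] that by simp
  have "f (t i) * W $$ (i, j) = W $$ (i, j) * f (s j)" if "i < n" "j < n" for i j
    using eq_ij[OF that] by (cases "W $$ (i, j) = 0") auto
  then have "mat_diag n (\<lambda>i. f (t i)) * W = W * mat_diag n (\<lambda>i. f (s i))"
    unfolding mat_diag_mult_left[OF W] mat_diag_mult_right[OF W] by (auto intro!: eq_matI)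
  then have "V * (mat_diag n (\<lambda>i. f (t i)) * W) * transpose_mat U
      = V * (W * mat_diag n (\<lambda>i. f (s i))) * transpose_mat U" by simp
  moreover have "V * (mat_diag n (\<lambda>i. f (t i)) * W) * transpose_mat U = spectral_fun n V (\<lambda>i. f (t i))"
    using U c by (simp add: spectral_fun_def W_def square_mult[of _ n] orthonormal_mat_def
        right_mult_one_mat[OF mat_diag_dim])
  moreover have "V * (W * mat_diag n (\<lambda>i. f (s i))) * transpose_mat U = spectral_fun n U (\<lambda>i. f (s i))"
    using c by (simp add: spectral_fun_def W_def square_mult[of _ n]
        orthonormal_mat_cancel(2)[OF V, of _ n])
  ultimately show ?thesis by simp
qed

section \<open>Powers and the Moore-Penrose pseudoinverse\<close>

lemma psd_pow_nonneg_eq: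
  assumes U: "orthonormal_mat n U" and s: "\<And>i. i < n \<Longrightarrow> 0 \<le> s i"
  shows "psd_pow_nonneg (spectral_fun n U s) a = spectral_fun n U (\<lambda>i. nonneg_pow (s i) a)"
proof -
  define A where "A = spectral_fun n U s"
  have A: "A \<in> carrier_mat n n" using U by (simp add: A_def)
  have "psd_pow_nonneg A a = spectral_fun n U (\<lambda>i. nonneg_pow (s i) a)"
    unfolding psd_pow_nonneg_def
  \<comment> \<open>The definite description is legitimate because
    \<open>spectral_fun_unique\<close> makes the power the same for every decomposition.\<close>
  proof (rule the_equality)
    show "\<exists>V t. spectral_decomp A V t \<and> spectral_fun n U (\<lambda>i. nonneg_pow (s i) a)
        = V * mat_diag (dim_row A) (\<lambda>i. nonneg_pow (t i) a) * transpose_mat V"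
    proof (intro exI conjI)
      show "spectral_decomp A U s"
        using U s unfolding spectral_decomp_alt[OF A] by (simp add: A_def spectral_fun_def)
    qed (use A in \<open>auto simp: spectral_fun_def\<close>)
  next
    fix B assume "\<exists>V t. spectral_decomp A V t \<and>
      B = V * mat_diag (dim_row A) (\<lambda>i. nonneg_pow (t i) a) * transpose_mat V"
    then obtain V t where "orthonormal_mat n V" "A = spectral_fun n V t"
      and B: "B = spectral_fun n V (\<lambda>i. nonneg_pow (t i) a)"
      using A by (auto simp: spectral_decomp_alt[OF A] spectral_fun_def)
    then show "B = spectral_fun n U (\<lambda>i. nonneg_pow (s i) a)"
      using spectral_fun_unique[OF U, of V s t "\<lambda>x. nonneg_pow x a"] by (simp add: A_def)
  qed
  then show ?thesis by (simp add: A_def)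
qed

text \<open>Transposing AP = (AQ)(AP) gives AP = AQ, since these products are symmetric; likewise PA
  = QA. Then P = PAP = QAP = QAQ = Q.\<close>

lemma is_pinv_unique:
  assumes A: "A \<in> carrier_mat m n" and P: "is_pinv A P" and Q: "is_pinv A Q"
  shows "P = Q"
proof -
  have c: "P \<in> carrier_mat n m" "Q \<in> carrier_mat n m"
    using A P Q by (auto simp: is_pinv_def)
  have AP: "A * P \<in> carrier_mat m m" "A * Q \<in> carrier_mat m m"
    and PA: "P * A \<in> carrier_mat n n" "Q * A \<in> carrier_mat n n" using A c by auto
  have "A * P = (A * Q) * (A * P)"
    using A c Q by (simp add: is_pinv_def flip: assoc_mult_mat[of _ m m _ n _ m])
  then have "transpose_mat (A * P) = transpose_mat ((A * Q) * (A * P))" by simp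
  also have "\<dots> = (A * P) * (A * Q)"
    unfolding transpose_mult[OF AP(2,1)] using P Q by (simp add: is_pinv_def)
  also have "\<dots> = A * Q"
    using A c P by (simp add: is_pinv_def flip: assoc_mult_mat[of _ m m _ n _ m])
  finally have 1: "A * P = A * Q" using P by (simp add: is_pinv_def)
  have "P * A = (P * A) * (Q * A)"
    using A c Q by (simp add: is_pinv_def assoc_mult_mat[of _ n m _ n _ n]
        assoc_mult_mat[of _ m n _ m _ n])
  then have "transpose_mat (P * A) = transpose_mat ((P * A) * (Q * A))" by simp
  also have "\<dots> = (Q * A) * (P * A)"
    unfolding transpose_mult[OF PA] using P Q by (simp add: is_pinv_def)
  also have "\<dots> = Q * A"
    using A c P by (simp add: is_pinv_def assoc_mult_mat[of _ n m _ n _ n]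
        assoc_mult_mat[of _ m n _ m _ n])
  finally have 2: "P * A = Q * A" using P by (simp add: is_pinv_def)
  have "P = P * A * P" using P by (simp add: is_pinv_def)
  also have "\<dots> = Q * (A * P)" using A c by (simp add: 2 assoc_mult_mat[of _ n m _ n _ m])
  also have "\<dots> = Q * A * Q" using A c by (simp add: 1 assoc_mult_mat[of _ n m _ n _ m])
  also have "\<dots> = Q" using Q by (simp add: is_pinv_def)
  finally show ?thesis .
qed

text \<open>Since \<open>inverse 0 = 0\<close>, the entrywise inverse satisfies the Penrose
  conditions on zero eigenvalues too.\<close>

lemma pinv_spectral_fun:
  assumes U: "orthonormal_mat n U"
  shows "pinv (spectral_fun n U s) = spectral_fun n U (\<lambda>i. inverse (s i))"
  unfolding pinv_def
proof (rule the_equality)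
  have c: "spectral_fun n U t \<in> carrier_mat n n" for t using U by simp
  have inv: "s i * inverse (s i) * s i = s i" "inverse (s i) * s i * inverse (s i) = inverse (s i)" for i
    by (cases "s i = 0"; simp)+
  show P: "is_pinv (spectral_fun n U s) (spectral_fun n U (\<lambda>i. inverse (s i)))"
    using c[of s] c[of "\<lambda>i. inverse (s i)"] U
    by (simp add: is_pinv_def spectral_fun_mult inv spectral_fun_transpose carrier_matD[OF c])
  show "P = spectral_fun n U (\<lambda>i. inverse (s i))" if "is_pinv (spectral_fun n U s) P" for P
    using is_pinv_unique[OF c that P] .
qed

text \<open>One formula serves both signs of \<open>a\<close>: for negative \<open>a\<close>, the
  detour through the pseudoinverse and \<open>nonneg_pow 0 a\<close> both give 0 at a zero
  eigenvalue.\<close>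

lemma psd_pow_eq:
  assumes U: "orthonormal_mat n U" and s: "\<And>i. i < n \<Longrightarrow> 0 \<le> s i"
  shows "psd_pow (spectral_fun n U s) a = spectral_fun n U (\<lambda>i. nonneg_pow (s i) a)"
proof (cases "0 \<le> a")
  case True
  then show ?thesis using psd_pow_nonneg_eq[OF assms] by (simp add: psd_pow_def)
next
  case False
  have "psd_pow (spectral_fun n U s) a = spectral_fun n U (\<lambda>i. nonneg_pow (inverse (s i)) (- a))"
    using False psd_pow_nonneg_eq[OF U, of "\<lambda>i. inverse (s i)" "- a"] s
    by (simp add: psd_pow_def pinv_spectral_fun[OF U])
  also have "\<dots> = spectral_fun n U (\<lambda>i. nonneg_pow (s i) a)"
    using False s by (intro spectral_fun_cong) (auto simp: nonneg_pow_def powr_minus inverse_powr)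
  finally show ?thesis .
qed

section \<open>Gram matrices and singular values\<close>

lemma gram_spectral_decomp:
  fixes M :: "real mat"
  assumes M: "M \<in> carrier_mat m n"
  obtains V s where "orthonormal_mat n V" "\<And>i. i < n \<Longrightarrow> 0 \<le> s i"
    "transpose_mat M * M = spectral_fun n V s"
proof -
  define A where "A = transpose_mat M * M"
  have A: "A \<in> carrier_mat n n" using M by (simp add: A_def)
  have "transpose_mat A = A" using M by (simp add: A_def transpose_mult[of _ n m _ n])
  then obtain V s where V: "orthonormal_mat n V" and AV: "A = spectral_fun n V s"
    using spectral_theorem[OF A] by (auto simp: spectral_fun_def)
  have c: "V \<in> carrier_mat n n" using V by (simp add: orthonormal_mat_def)
  have "transpose_mat (M * V) * (M * V) = transpose_mat V * (A * V)"
    using M c by (simp add: A_def transpose_mult[of _ m n _ n] assoc_mult_mat[of _ n m _ n _ n]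
        assoc_mult_mat[of _ n n _ m _ n])
  also have "\<dots> = mat_diag n s"
    using V c by (simp add: AV spectral_fun_def square_mult[of _ n]
        orthonormal_mat_cancel(1)[OF V, of _ n])
      (simp add: orthonormal_mat_def right_mult_one_mat[OF mat_diag_dim])
  finally have G: "transpose_mat (M * V) * (M * V) = mat_diag n s" .
  \<comment> \<open>The eigenvalue is the squared length of column i of M V.\<close>
  have "0 \<le> s i" if "i < n" for i
  proof -
    have "s i = (transpose_mat (M * V) * (M * V)) $$ (i, i)" using G that by (simp add: mat_diag_def)
    also have "\<dots> = scalar_prod (col (M * V) i) (col (M * V) i)" using M c that by simp
    also have "\<dots> \<ge> 0" by (simp add: scalar_prod_def sum_nonneg)
    finally show ?thesis .
  qed
  then show thesis by (rule that[OF V]) (use AV in \<open>auto simp: A_def\<close>)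
qed

text \<open>Similar matrices share their characteristic polynomial, and that of a diagonal matrix
  splits into the factors x - s_i. Its root multiset is therefore that of the s_i, whatever their
  order.\<close>

lemma schatten_norm_spectral:
  assumes V: "orthonormal_mat n V" and M: "transpose_mat M * M = spectral_fun n V s"
  shows "schatten_norm r M = lr_norm r (map (\<lambda>i. sqrt (s i)) [0..<n])"
proof -
  have c: "V \<in> carrier_mat n n" using V by (simp add: orthonormal_mat_def)
  have "similar_mat_wit (spectral_fun n V s) (mat_diag n s) V (transpose_mat V)"
    by (rule similar_mat_witI[of _ _ n]) (use V c in \<open>auto simp: spectral_fun_def orthonormal_mat_def\<close>)
  then have "similar_mat (spectral_fun n V s) (mat_diag n s)"
    unfolding similar_mat_def by blast
  then have "char_poly (spectral_fun n V s) = char_poly (mat_diag n s)" by (rule char_poly_similar)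
  also have "\<dots> = (\<Prod>a\<leftarrow>diag_mat (mat_diag n s). [:- a, 1:])"
    by (rule char_poly_upper_triangular[of _ n]) (auto simp: mat_diag_def)
  also have "diag_mat (mat_diag n s) = map s [0..<n]" by (auto simp: diag_mat_def mat_diag_def)
  finally have cp: "char_poly (transpose_mat M * M) = (\<Prod>p\<leftarrow>map (\<lambda>i. [:- s i, 1:]) [0..<n]. p)"
    by (simp add: M o_def)
  have "proots (char_poly (transpose_mat M * M)) = (\<Sum>x\<leftarrow>[0..<n]. {#s x#})"
    unfolding cp by (subst proots_prod_list) (auto simp: o_def)
  also have "\<dots> = mset (map s [0..<n])" by (induction n) auto
  finally have "mset (singular_values M) = mset (map (\<lambda>i. sqrt (s i)) [0..<n])"
    by (simp add: singular_values_def flip: image_mset.compositionality)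
      (simp add: image_mset.compositionality o_def)
  then show ?thesis unfolding schatten_norm_def by (rule lr_norm_mset_cong)
qed

subsection \<open>Schatten norms\<close>

lemma schatten_norm_nonneg [simp]: "0 \<le> schatten_norm r M"
  by (simp add: schatten_norm_def)

lemma trace_inner_sum:
  assumes "A \<in> carrier_mat m n" "B \<in> carrier_mat m n"
  shows "trace_inner A B = (\<Sum>j<n. \<Sum>i<m. A $$ (i, j) * B $$ (i, j))"
  using assms by (simp add: trace_inner_def scalar_prod_def lessThan_atLeast0)

lemma trace_inner_smult:
  assumes "A \<in> carrier_mat m n" "B \<in> carrier_mat m n"
  shows "trace_inner A (c \<cdot>\<^sub>m B) = c * trace_inner A B"
  using assms by (simp add: trace_inner_sum[of _ m n] sum_distrib_left mult.left_commute)

text \<open>By cyclicity of the trace, V^T (A^T B) V and A^T B have equal trace.\<close>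

lemma trace_inner_mult_orthonormal:
  assumes V: "orthonormal_mat n V" and A: "A \<in> carrier_mat m n" and B: "B \<in> carrier_mat m n"
  shows "trace_inner (A * V) (B * V) = trace_inner A B"
proof -
  have c: "V \<in> carrier_mat n n" using V by (simp add: orthonormal_mat_def)
  define C where "C = transpose_mat A * B"
  have C: "C \<in> carrier_mat n n" using A B by (simp add: C_def)
  have trace_comm: "(\<Sum>i<n. (X * Y) $$ (i, i)) = (\<Sum>i<n. (Y * X) $$ (i, i))"
    if "X \<in> carrier_mat n n" "Y \<in> carrier_mat n n" for X Y :: "real mat"
  proof -
    have "(\<Sum>i<n. (X * Y) $$ (i, i)) = (\<Sum>i<n. \<Sum>j<n. X $$ (i, j) * Y $$ (j, i))"
      using that by (simp add: scalar_prod_def lessThan_atLeast0)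
    also have "\<dots> = (\<Sum>j<n. \<Sum>i<n. Y $$ (j, i) * X $$ (i, j))"
      by (subst sum.swap) (simp add: mult.commute)
    also have "\<dots> = (\<Sum>i<n. (Y * X) $$ (i, i))"
      using that by (simp add: scalar_prod_def lessThan_atLeast0)
    finally show ?thesis .
  qed
  have "transpose_mat (A * V) * (B * V) = transpose_mat V * (C * V)"
    using A B c by (simp add: C_def transpose_mult[of _ m n _ n] assoc_mult_mat[of _ n n _ m _ n]
        assoc_mult_mat[of _ n m _ n _ n])
  then have "trace_inner (A * V) (B * V) = (\<Sum>i<n. (transpose_mat V * (C * V)) $$ (i, i))"
    using c by (simp add: trace_inner_def)
  also have "\<dots> = (\<Sum>i<n. ((C * V) * transpose_mat V) $$ (i, i))"
    using c C by (intro trace_comm) auto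
  also have "(C * V) * transpose_mat V = C"
    using V c C by (simp add: square_mult[of _ n] orthonormal_mat_def right_mult_one_mat[of _ n n])
  also have "(\<Sum>i<n. C $$ (i, i)) = trace_inner A B" using B A by (simp add: trace_inner_def C_def)
  finally show ?thesis .
qed

text \<open>Both sides are the i-th diagonal entry of (Z V)^T (Z V) = W^T diag(t) W with W = B^T
  V.\<close>

lemma col_mult_norm:
  assumes V: "orthonormal_mat n V" and B: "orthonormal_mat n B"
    and Z: "Z \<in> carrier_mat m n" "transpose_mat Z * Z = spectral_fun n B t" and i: "i < n"
  shows "(\<Sum>k<m. ((Z * V) $$ (k, i))\<^sup>2) = (\<Sum>k<n. ((transpose_mat B * V) $$ (k, i))\<^sup>2 * t k)"
proof -
  have c: "V \<in> carrier_mat n n" "B \<in> carrier_mat n n"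
    using V B by (auto simp: orthonormal_mat_def)
  define W where "W = transpose_mat B * V"
  have W: "W \<in> carrier_mat n n" using c by (simp add: W_def)
  have "transpose_mat (Z * V) * (Z * V) = transpose_mat V * (spectral_fun n B t * V)"
    using Z c unfolding Z(2)[symmetric]
    by (simp add: transpose_mult[of _ m n _ n] assoc_mult_mat[of _ n n _ m _ n]
        assoc_mult_mat[of _ n m _ n _ n])
  also have "\<dots> = transpose_mat W * (mat_diag n t * W)"
    using c by (simp add: spectral_fun_def W_def square_mult[of _ n] transpose_mult[of _ n n _ n])
  finally have "(transpose_mat (Z * V) * (Z * V)) $$ (i, i) = (transpose_mat W * (mat_diag n t * W)) $$ (i, i)"
    by simp
  moreover have "(transpose_mat (Z * V) * (Z * V)) $$ (i, i) = (\<Sum>k<m. ((Z * V) $$ (k, i))\<^sup>2)"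
    using Z c i by (simp add: scalar_prod_def lessThan_atLeast0 power2_eq_square del: index_mult_mat(1))
      (simp add: scalar_prod_def)
  moreover have "(transpose_mat W * (mat_diag n t * W)) $$ (i, i) = (\<Sum>k<n. (W $$ (k, i))\<^sup>2 * t k)"
    unfolding mat_diag_mult_left[OF W] using W i
    by (simp add: scalar_prod_def lessThan_atLeast0 power2_eq_square mult_ac)
  ultimately show ?thesis by (simp add: W_def)
qed

text \<open>The squared entries form a doubly stochastic matrix, the source of the averaging weights
  below.\<close>

lemma orthonormal_mat_sum_squares:
  assumes "orthonormal_mat n W" "i < n"
  shows "(\<Sum>k<n. (W $$ (k, i))\<^sup>2) = 1" "(\<Sum>k<n. (W $$ (i, k))\<^sup>2) = 1"
proof -
  have W: "W \<in> carrier_mat n n" "transpose_mat W * W = 1\<^sub>m n" "W * transpose_mat W = 1\<^sub>m n"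
    using assms by (auto simp: orthonormal_mat_def)
  show "(\<Sum>k<n. (W $$ (k, i))\<^sup>2) = 1"
    using arg_cong[OF W(2), of "\<lambda>A. A $$ (i, i)"] W(1) assms(2)
    by (simp add: scalar_prod_def lessThan_atLeast0 power2_eq_square)
  show "(\<Sum>k<n. (W $$ (i, k))\<^sup>2) = 1"
    using arg_cong[OF W(3), of "\<lambda>A. A $$ (i, i)"] W(1) assms(2)
    by (simp add: scalar_prod_def lessThan_atLeast0 power2_eq_square)
qed

text \<open>The assumption on \<open>p\<close> enters as p/2 \<ge> 1, the exponent for Jensen
  applied to squared norms. For infinite \<open>p\<close> an average simply does not exceed the
  maximum.\<close>

lemma lr_norm_col_norms_le:
  assumes V: "orthonormal_mat n V" and Z: "Z \<in> carrier_mat m n" and p: "2 \<le> p"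
  shows "lr_norm p (map (\<lambda>i. sqrt (\<Sum>k<m. ((Z * V) $$ (k, i))\<^sup>2)) [0..<n]) \<le> schatten_norm p Z"
proof -
  obtain B t where B: "orthonormal_mat n B" and t: "\<And>i. i < n \<Longrightarrow> 0 \<le> t i"
    and ZB: "transpose_mat Z * Z = spectral_fun n B t"
    using gram_spectral_decomp[OF Z] by blast
  define w where "w k i = ((transpose_mat B * V) $$ (k, i))\<^sup>2" for k i
  define \<nu> where "\<nu> i = (\<Sum>k<n. w k i * t k)" for i
  note W = orthonormal_mat_mult[OF orthonormal_mat_transpose[OF B] V]
  have w: "0 \<le> w k i" for k i by (simp add: w_def)
  \<comment> \<open>Column sums make each \<nu>_i a weighted mean of the t_k; row sums remove the
    weights once the double sum is swapped.\<close>
  have w_col: "(\<Sum>k<n. w k i) = 1" and w_row: "(\<Sum>k<n. w i k) = 1" if "i < n" for i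
    using orthonormal_mat_sum_squares[OF W that] by (simp_all add: w_def)
  have \<nu>: "0 \<le> \<nu> i" for i using w t by (auto simp: \<nu>_def intro!: sum_nonneg)
  have norms: "map (\<lambda>i. sqrt (\<Sum>k<m. ((Z * V) $$ (k, i))\<^sup>2)) [0..<n] = map (\<lambda>i. sqrt (\<nu> i)) [0..<n]"
    using col_mult_norm[OF V B Z ZB] by (auto simp: \<nu>_def w_def)
  have schatten: "schatten_norm p Z = lr_norm p (map (\<lambda>i. sqrt (t i)) [0..<n])"
    using schatten_norm_spectral[OF B ZB] .
  show ?thesis
  proof (cases p)
    case (real a)
    then have a: "2 \<le> a" using p by simp
    have sqrt_powr: "sqrt x powr a = x powr (a / 2)" if "0 \<le> x" for x
      using that by (simp add: powr_half_sqrt[symmetric] powr_powr)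
    have "(\<Sum>i<n. \<nu> i powr (a / 2)) \<le> (\<Sum>i<n. \<Sum>k<n. w k i * t k powr (a / 2))"
      unfolding \<nu>_def using a w w_col t by (intro sum_mono powr_Jensen) auto
    also have "\<dots> = (\<Sum>k<n. (\<Sum>i<n. w k i) * t k powr (a / 2))"
      by (subst sum.swap) (simp add: sum_distrib_right)
    also have "\<dots> = (\<Sum>k<n. t k powr (a / 2))" by (simp add: w_row)
    finally have "(\<Sum>i<n. \<bar>sqrt (\<nu> i)\<bar> powr a) \<le> (\<Sum>i<n. \<bar>sqrt (t i)\<bar> powr a)"
      using \<nu> t by (simp add: sqrt_powr)
    then show ?thesis unfolding norms schatten using a real
      by (simp add: lr_norm_real_map powr_mono2 sum_nonneg lessThan_atLeast0)
  next
    case PInf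
    define T where "T = lr_norm \<infinity> (map (\<lambda>i. sqrt (t i)) [0..<n])"
    have T: "sqrt (t i) \<le> T" if "i < n" for i
      using lr_norm_infinity_le_iff[of "\<lambda>i. sqrt (t i)" "[0..<n]" T] that unfolding T_def
      by (fastforce intro: order_trans[OF abs_ge_self])
    have "\<nu> i \<le> T\<^sup>2" if i: "i < n" for i
    proof -
      have "t k \<le> T\<^sup>2" if "k < n" for k
        using power_mono[OF T[OF that], of 2] t[OF that] by simp
      then have "\<nu> i \<le> (\<Sum>k<n. w k i * T\<^sup>2)"
        unfolding \<nu>_def using w by (intro sum_mono mult_left_mono) auto
      also have "\<dots> = T\<^sup>2" using w_col[OF i] by (simp flip: sum_distrib_right)
      finally show ?thesis .
    qed
    then have "\<forall>i<n. \<bar>sqrt (\<nu> i)\<bar> \<le> T"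
      using \<nu> real_sqrt_le_mono[of "\<nu> _" "T\<^sup>2"] by (auto simp: T_def)
    moreover have "T = schatten_norm p Z" using schatten PInf by (simp add: T_def)
    ultimately show ?thesis unfolding norms PInf by (auto simp: lr_norm_infinity_le_iff)
  qed (use p in auto)
qed

text \<open>Cauchy-Schwarz is used within each column and \<open>lr_norm_Hoelder\<close> across
  columns; \<open>lr_norm_col_norms_le\<close> then returns from the columns of Z V to Z.\<close>

lemma schatten_Hoelder:
  assumes M: "M \<in> carrier_mat m n" and Z: "Z \<in> carrier_mat m n"
    and conj: "conjugate_exponents p (ereal q)" and p: "2 \<le> p"
  shows "\<bar>trace_inner M Z\<bar> \<le> schatten_norm (ereal q) M * schatten_norm p Z"
proof -
  obtain V s where V: "orthonormal_mat n V" and s: "\<And>i. i < n \<Longrightarrow> 0 \<le> s i"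
    and MV: "transpose_mat M * M = spectral_fun n V s"
    using gram_spectral_decomp[OF M] by blast
  have c: "V \<in> carrier_mat n n" using V by (simp add: orthonormal_mat_def)
  define z where "z i = sqrt (\<Sum>k<m. ((Z * V) $$ (k, i))\<^sup>2)" for i
  have z: "0 \<le> z i" for i by (simp add: z_def sum_nonneg)
  have VV: "(transpose_mat V * V) $$ (k, i) = (if k = i then 1 else 0)" if "k < n" "i < n" for k i
    using V that by (simp add: orthonormal_mat_def)
  \<comment> \<open>For the eigenbasis of M itself the averaging weights reduce to the identity
    matrix.\<close>
  have colM: "(\<Sum>k<m. ((M * V) $$ (k, i))\<^sup>2) = s i" if i: "i < n" for i
  proof -
    have "(\<Sum>k<m. ((M * V) $$ (k, i))\<^sup>2) = (\<Sum>k<n. if k = i then s k else 0)"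
      unfolding col_mult_norm[OF V V M MV i] using VV i by (intro sum.cong) auto
    also have "\<dots> = s i" using i by simp
    finally show ?thesis .
  qed
  have "trace_inner M Z = (\<Sum>i<n. \<Sum>k<m. (M * V) $$ (k, i) * (Z * V) $$ (k, i))"
    using trace_inner_mult_orthonormal[OF V M Z] trace_inner_sum[of "M * V" m n "Z * V"] M Z c by simp
  then have "\<bar>trace_inner M Z\<bar> \<le> (\<Sum>i<n. \<bar>\<Sum>k<m. (M * V) $$ (k, i) * (Z * V) $$ (k, i)\<bar>)"
    by simp
  also have "\<dots> \<le> (\<Sum>i<n. \<bar>sqrt (s i)\<bar> * \<bar>z i\<bar>)"
  proof (rule sum_mono)
    fix i assume "i \<in> {..<n}"
    then have i: "i < n" by simp
    have "(\<Sum>k<m. (M * V) $$ (k, i) * (Z * V) $$ (k, i))\<^sup>2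
        \<le> (\<Sum>k<m. ((M * V) $$ (k, i))\<^sup>2) * (\<Sum>k<m. ((Z * V) $$ (k, i))\<^sup>2)"
      by (rule Cauchy_Schwarz_ineq_sum)
    then have "sqrt ((\<Sum>k<m. (M * V) $$ (k, i) * (Z * V) $$ (k, i))\<^sup>2) \<le> sqrt (s i) * z i"
      unfolding z_def colM[OF i] real_sqrt_mult[symmetric] by (rule real_sqrt_le_mono)
    then show "\<bar>\<Sum>k<m. (M * V) $$ (k, i) * (Z * V) $$ (k, i)\<bar> \<le> \<bar>sqrt (s i)\<bar> * \<bar>z i\<bar>"
      using s[OF i] z[of i] by simp
  qed
  also have "\<dots> \<le> schatten_norm (ereal q) M * lr_norm p (map z [0..<n])"
    unfolding schatten_norm_spectral[OF V MV]
    using lr_norm_Hoelder[OF conj, of "[0..<n]" "\<lambda>i. sqrt (s i)" z] by (simp add: lessThan_atLeast0)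
  also have "\<dots> \<le> schatten_norm (ereal q) M * schatten_norm p Z"
    using lr_norm_col_norms_le[OF V Z p]
    by (intro mult_left_mono) (auto simp: z_def[abs_def])
  finally show ?thesis .
qed

section \<open>Homogeneity and definiteness of Schatten norms\<close>

lemma schatten_norm_smult:
  assumes M: "M \<in> carrier_mat m n" and r: "1 \<le> r"
  shows "schatten_norm r (c \<cdot>\<^sub>m M) = \<bar>c\<bar> * schatten_norm r M"
proof -
  obtain V s where V: "orthonormal_mat n V" and s: "\<And>i. i < n \<Longrightarrow> 0 \<le> s i"
    and MV: "transpose_mat M * M = spectral_fun n V s"
    using gram_spectral_decomp[OF M] by blast
  have "transpose_mat (c \<cdot>\<^sub>m M) * (c \<cdot>\<^sub>m M) = c\<^sup>2 \<cdot>\<^sub>m (transpose_mat M * M)"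
    using M by (auto intro!: eq_matI simp: power2_eq_square scalar_prod_def sum_distrib_left mult_ac)
  also have "\<dots> = spectral_fun n V (\<lambda>i. c\<^sup>2 * s i)"
  proof -
    have c: "V \<in> carrier_mat n n" using V by (simp add: orthonormal_mat_def)
    have "mat_diag n (\<lambda>i. c\<^sup>2 * s i) = c\<^sup>2 \<cdot>\<^sub>m mat_diag n s" by (rule eq_matI) (auto simp: mat_diag_def)
    then show ?thesis using c unfolding MV spectral_fun_def
      by (simp add: mult_smult_distrib[of _ n n _ n] mult_smult_assoc_mat[of _ n n _ n] square_mult[of _ n])
  qed
  finally show ?thesis
    using schatten_norm_spectral[OF V] lr_norm_scale[OF r, of c "\<lambda>i. sqrt (s i)" "[0..<n]"]
      lr_norm_scale[OF r, of "\<bar>c\<bar>" "\<lambda>i. sqrt (s i)" "[0..<n]"] MV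
    by (simp add: real_sqrt_mult)
qed

lemma schatten_norm_zero: "1 \<le> r \<Longrightarrow> schatten_norm r (0\<^sub>m m n) = 0"
  using schatten_norm_smult[of "0\<^sub>m m n" m n r 0] by simp

text \<open>Norm zero kills every eigenvalue of M^T M, hence its trace, which is the sum of the
  squared entries of M.\<close>

lemma schatten_norm_pos:
  assumes M: "M \<in> carrier_mat m n" "M \<noteq> 0\<^sub>m m n" and r: "1 \<le> r"
  shows "0 < schatten_norm r M"
proof (rule ccontr)
  assume "\<not> ?thesis"
  then have 0: "schatten_norm r M = 0" using schatten_norm_nonneg[of r M] by linarith
  obtain V s where V: "orthonormal_mat n V" and s: "\<And>i. i < n \<Longrightarrow> 0 \<le> s i"
    and MV: "transpose_mat M * M = spectral_fun n V s"
    using gram_spectral_decomp[OF M(1)] by blast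
  have c: "V \<in> carrier_mat n n" using V by (simp add: orthonormal_mat_def)
  have "s i = 0" if "i < n" for i
    using 0 that unfolding schatten_norm_spectral[OF V MV] lr_norm_eq_0_iff[OF r] by simp
  then have "mat_diag n s = 0\<^sub>m n n" by (auto intro!: eq_matI simp: mat_diag_def)
  then have "transpose_mat M * M = 0\<^sub>m n n" using c unfolding MV spectral_fun_def
    by (simp add: right_mult_zero_mat[of _ n n] left_mult_zero_mat[of _ n n])
  then have "trace_inner M M = 0" using M by (simp add: trace_inner_def)
  then have "(\<Sum>j<n. \<Sum>i<m. (M $$ (i, j))\<^sup>2) = 0"
    using M by (simp add: trace_inner_sum[of M m n] power2_eq_square)
  then have "M $$ (i, j) = 0" if "i < m" "j < n" for i j
    using that by (subst (asm) sum_nonneg_eq_0_iff; simp add: sum_nonneg sum_nonneg_eq_0_iff)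
  then have "M = 0\<^sub>m m n" using M by (intro eq_matI) auto
  with M show False by simp
qed

section \<open>The selected minimizer over a Schatten ball\<close>

lemma trace_spectral_fun:
  assumes V: "orthonormal_mat n V"
  shows "(\<Sum>i<n. spectral_fun n V s $$ (i, i)) = sum s {..<n}"
proof -
  have c: "V \<in> carrier_mat n n" using V by (simp add: orthonormal_mat_def)
  have "(\<Sum>i<n. spectral_fun n V s $$ (i, i)) = (\<Sum>i<n. \<Sum>k<n. (V $$ (i, k))\<^sup>2 * s k)"
    using c unfolding spectral_fun_def mat_diag_mult_right[OF c]
    by (simp add: scalar_prod_def lessThan_atLeast0 power2_eq_square mult_ac)
  also have "\<dots> = (\<Sum>k<n. (\<Sum>i<n. (V $$ (i, k))\<^sup>2) * s k)"
    by (subst sum.swap) (simp add: sum_distrib_right)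
  also have "\<dots> = sum s {..<n}" using orthonormal_mat_sum_squares[OF V] by simp
  finally show ?thesis .
qed

text \<open>Up to a negative factor, \<open>Delta_b q M\<close> is D = M h(M^T M), with singular
  values h_i \<sigma>_i and inner product with M equal to the sum of s_i h_i. Both claims thus
  reduce to the scalar dual vector of \<sigma>.\<close>

lemma Delta_b_minimizes:
  assumes M: "M \<in> carrier_mat m n" and conj: "conjugate_exponents p (ereal q)" and p: "2 \<le> p"
  shows "Delta_b q M \<in> carrier_mat m n"
    and "trace_inner M (Delta_b q M) = - schatten_norm (ereal q) M"
    and "schatten_norm p (Delta_b q M) \<le> 1"
proof -
  have p1: "1 \<le> p" and q1: "1 \<le> q"
    using conj by (auto simp: conjugate_exponents_def one_ereal_def)
  then have q1': "1 \<le> ereal q" by (simp add: one_ereal_def)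
  have "Delta_b q M \<in> carrier_mat m n \<and> trace_inner M (Delta_b q M) = - schatten_norm (ereal q) M
    \<and> schatten_norm p (Delta_b q M) \<le> 1"
  proof (cases "M = 0\<^sub>m m n")
    case True
    then show ?thesis using schatten_norm_zero[OF p1] schatten_norm_zero[OF q1']
      by (simp add: Delta_b_def trace_inner_sum[of _ m n])
  next
    case False
    define N where "N = schatten_norm (ereal q) M"
    have N: "0 < N" unfolding N_def by (rule schatten_norm_pos[OF M False q1'])
    obtain V s where V: "orthonormal_mat n V" and s: "\<And>i. i < n \<Longrightarrow> 0 \<le> s i"
      and MV: "transpose_mat M * M = spectral_fun n V s"
      using gram_spectral_decomp[OF M] by blast
    define \<sigma> where "\<sigma> i = sqrt (s i)" for i
    have \<sigma>: "0 \<le> \<sigma> i" "s i = (\<sigma> i)\<^sup>2" if "i < n" for i using s[OF that] by (auto simp: \<sigma>_def)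
    have N_\<sigma>: "N = lr_norm (ereal q) (map \<sigma> [0..<n])"
      using schatten_norm_spectral[OF V MV] by (simp add: N_def \<sigma>_def[abs_def])
    define h where "h i = nonneg_pow (s i) ((q - 2) / 2)" for i
    have h: "0 \<le> h i" for i by (simp add: h_def nonneg_pow_def)
    \<comment> \<open>Zero singular values are excluded: for q = 2, \<open>nonneg_pow 0 0\<close> is
      1 while \<open>0 powr 0\<close> is 0. The products with \<sigma>_i below hide this
      difference.\<close>
    have h_powr: "h i = \<sigma> i powr (q - 2)" if "i < n" "\<sigma> i \<noteq> 0" for i
    proof (cases "q = 2")
      case False
      have "h i = (\<sigma> i powr 2) powr ((q - 2) / 2)"
        using False \<sigma>[OF that(1)] by (simp add: h_def nonneg_pow_def)
      also have "\<dots> = \<sigma> i powr (q - 2)"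
        unfolding powr_powr by (rule arg_cong[of _ _ "(powr) (\<sigma> i)"]) (simp add: field_simps)
      finally show ?thesis .
    qed (use that \<sigma> in \<open>simp add: h_def nonneg_pow_def\<close>)
    have sh: "s i * h i = \<sigma> i * \<sigma> i powr (q - 1)" if "i < n" for i
    proof (cases "\<sigma> i = 0")
      case False
      have "\<sigma> i powr (q - 1) = \<sigma> i powr (1 + (q - 2))" by simp
      also have "\<dots> = \<sigma> i * \<sigma> i powr (q - 2)" using \<sigma>[OF that] False by (subst powr_add) simp
      finally show ?thesis using \<sigma>[OF that] h_powr[OF that False] by (simp add: power2_eq_square)
    qed (use \<sigma>[OF that] in simp)
    have h\<sigma>: "h i * \<sigma> i \<le> \<sigma> i powr (q - 1)" if "i < n" for i
    proof (cases "\<sigma> i = 0")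
      case False
      then have "\<sigma> i * (h i * \<sigma> i) = \<sigma> i * \<sigma> i powr (q - 1)"
        using sh[OF that] \<sigma>[OF that] by (simp add: power2_eq_square mult_ac)
      then show ?thesis using False by (simp add: mult.commute)
    qed simp
    define D where "D = M * spectral_fun n V h"
    have D: "D \<in> carrier_mat m n" using M spectral_fun_carrier[OF V, of h] by (simp add: D_def)
    define k where "k = - 1 / N powr (q - 1)"
    have Delta: "Delta_b q M = k \<cdot>\<^sub>m D"
      using False M psd_pow_eq[OF V s] by (simp add: Delta_b_def N_def k_def D_def MV h_def[abs_def])
    have "transpose_mat M * D = spectral_fun n V (\<lambda>i. s i * h i)"
      using M spectral_fun_carrier[OF V, of h] unfolding D_def spectral_fun_mult[OF V, symmetric] MV[symmetric]
      by simp
    then have "trace_inner M D = (\<Sum>i<n. s i * h i)"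
      using trace_spectral_fun[OF V, of "\<lambda>i. s i * h i"] M spectral_fun_carrier[OF V, of h]
      by (simp add: trace_inner_def D_def)
    also have "\<dots> = (\<Sum>i<n. \<sigma> i * \<sigma> i powr (q - 1))" using sh by simp
    also have "\<dots> = N powr (q - 1) * (\<Sum>i<n. \<bar>\<sigma> i\<bar> * (\<bar>\<sigma> i\<bar> / N) powr (q - 1))"
      using N \<sigma> by (simp add: powr_divide sum_distrib_left)
    also have "(\<Sum>i<n. \<bar>\<sigma> i\<bar> * (\<bar>\<sigma> i\<bar> / N) powr (q - 1)) = N"
      using sum_dual_vector[OF q1 _ N_\<sigma> N] by (simp add: lessThan_atLeast0)
    finally have tr: "trace_inner M (Delta_b q M) = - N"
      using N unfolding Delta trace_inner_smult[OF M D] by (simp add: k_def)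
    \<comment> \<open>The Gram matrix of D is diagonal in the same eigenbasis, so its singular
      values can be read off.\<close>
    have "transpose_mat D * D = spectral_fun n V h * (transpose_mat M * M) * spectral_fun n V h"
      using M spectral_fun_carrier[OF V, of h] spectral_fun_carrier[OF V, of s]
      by (simp add: D_def transpose_mult[of _ m n _ n] spectral_fun_transpose[OF V]
          assoc_mult_mat[of _ n n _ m _ n] assoc_mult_mat[of _ n m _ n _ n] square_mult[of _ n])
    also have "\<dots> = spectral_fun n V (\<lambda>i. h i * s i * h i)"
      unfolding MV spectral_fun_mult[OF V] ..
    finally have "schatten_norm p D = lr_norm p (map (\<lambda>i. sqrt (h i * s i * h i)) [0..<n])"
      by (rule schatten_norm_spectral[OF V])
    also have "map (\<lambda>i. sqrt (h i * s i * h i)) [0..<n] = map (\<lambda>i. h i * \<sigma> i) [0..<n]"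
      using h by (auto simp: \<sigma>_def real_sqrt_mult)
    finally have "schatten_norm p (Delta_b q M) = lr_norm p (map (\<lambda>i. k * (h i * \<sigma> i)) [0..<n])"
      unfolding Delta schatten_norm_smult[OF D p1] lr_norm_scale[OF p1] by simp
    also have "\<dots> \<le> 1"
    proof (rule lr_norm_dual_vector_le[OF conj _ N_\<sigma> N])
      fix i assume "i \<in> set [0..<n]"
      then have i: "i < n" by simp
      have "\<bar>k * (h i * \<sigma> i)\<bar> = h i * \<sigma> i / N powr (q - 1)"
        using h[of i] \<sigma>[OF i] by (simp add: k_def abs_mult)
      also have "\<dots> \<le> \<sigma> i powr (q - 1) / N powr (q - 1)"
        using h\<sigma>[OF i] by (intro divide_right_mono) auto
      also have "\<dots> = (\<bar>\<sigma> i\<bar> / N) powr (q - 1)" using \<sigma>[OF i] N by (simp add: powr_divide)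
      finally show "\<bar>k * (h i * \<sigma> i)\<bar> \<le> (\<bar>\<sigma> i\<bar> / N) powr (q - 1)" .
    qed simp
    finally show ?thesis using tr D by (simp add: Delta N_def)
  qed
  then show "Delta_b q M \<in> carrier_mat m n" "trace_inner M (Delta_b q M) = - schatten_norm (ereal q) M"
    "schatten_norm p (Delta_b q M) \<le> 1" by auto
qed

subsection \<open>Block norms\<close>

text \<open>Matrix Hoelder in each block, then scalar Hoelder over the blocks; the weights L_j^(1/2)
  and L_j^(-1/2) cancel in each product.\<close>

lemma block_inner_Hoelder:
  assumes L: "\<And>j. j \<in> {1..J} \<Longrightarrow> 0 < L j"
    and conj: "conjugate_exponents \<alpha> (ereal \<beta>)"
    and p: "\<And>j. j \<in> {1..J} \<Longrightarrow> 2 \<le> p j"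
    and conj_j: "\<And>j. j \<in> {1..J} \<Longrightarrow> conjugate_exponents (p j) (ereal (q j))"
    and M: "M \<in> block_space J m n" and Z: "Z \<in> block_space J m n"
  shows "\<bar>block_inner J M Z\<bar> \<le> norm_vq J L \<beta> q M * norm_wp J L \<alpha> p Z"
proof -
  define a where "a j = L j powr (-1/2) * schatten_norm (ereal (q j)) (M j)" for j
  define b where "b j = L j powr (1/2) * schatten_norm (p j) (Z j)" for j
  have set: "set [1..<Suc J] = {1..J}" by auto
  have "\<bar>block_inner J M Z\<bar> \<le> (\<Sum>j\<in>{1..J}. \<bar>trace_inner (M j) (Z j)\<bar>)"
    by (simp add: block_inner_def)
  also have "\<dots> \<le> (\<Sum>j\<in>{1..J}. \<bar>a j\<bar> * \<bar>b j\<bar>)"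
  proof (rule sum_mono)
    fix j assume j: "j \<in> {1..J}"
    have "M j \<in> carrier_mat (m j) (n j)" "Z j \<in> carrier_mat (m j) (n j)"
      using M Z j by (auto simp: block_space_def)
    then have "\<bar>trace_inner (M j) (Z j)\<bar> \<le> schatten_norm (ereal (q j)) (M j) * schatten_norm (p j) (Z j)"
      using schatten_Hoelder conj_j[OF j] p[OF j] by blast
    also have "\<dots> = \<bar>a j\<bar> * \<bar>b j\<bar>"
      using L[OF j] by (simp add: a_def b_def abs_mult powr_minus field_simps)
    finally show "\<bar>trace_inner (M j) (Z j)\<bar> \<le> \<bar>a j\<bar> * \<bar>b j\<bar>" .
  qed
  also have "\<dots> \<le> norm_vq J L \<beta> q M * norm_wp J L \<alpha> p Z"
    using lr_norm_Hoelder[OF conj, of "[1..<Suc J]" a b] unfolding set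
    by (simp add: norm_vq_def norm_wp_def a_def[abs_def] b_def[abs_def] del: upt_Suc)
  finally show ?thesis .
qed

lemma norm_wp_smult:
  assumes "Z \<in> block_space J m n" "1 \<le> \<alpha>" "\<And>j. j \<in> {1..J} \<Longrightarrow> 1 \<le> p j"
  shows "norm_wp J L \<alpha> p (\<lambda>j. c \<cdot>\<^sub>m Z j) = \<bar>c\<bar> * norm_wp J L \<alpha> p Z"
proof -
  have "map (\<lambda>j. L j powr (1/2) * schatten_norm (p j) (c \<cdot>\<^sub>m Z j)) [1..<Suc J]
      = map (\<lambda>j. \<bar>c\<bar> * (L j powr (1/2) * schatten_norm (p j) (Z j))) [1..<Suc J]"
  proof (rule map_cong[OF refl])
    fix j assume "j \<in> set [1..<Suc J]"
    then have "j \<in> {1..J}" by auto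
    then show "L j powr (1/2) * schatten_norm (p j) (c \<cdot>\<^sub>m Z j)
        = \<bar>c\<bar> * (L j powr (1/2) * schatten_norm (p j) (Z j))"
      using assms(1) schatten_norm_smult[of "Z j" "m j" "n j" "p j" c] assms(3)
      by (simp add: block_space_def)
  qed
  then show ?thesis unfolding norm_wp_def by (simp only: lr_norm_scale[OF assms(2)] abs_abs)
qed

text \<open>The scalars w_j form the dual vector of the weighted block norms a_j, and each
  \<open>Delta_b\<close> attains equality in its own block; the two equality cases multiply.\<close>

lemma Z_ball_dual_norm_attained:
  assumes L: "\<And>j. j \<in> {1..J} \<Longrightarrow> 0 < L j"
    and conj: "conjugate_exponents \<alpha> (ereal \<beta>)"
    and p: "\<And>j. j \<in> {1..J} \<Longrightarrow> 2 \<le> p j"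
    and conj_j: "\<And>j. j \<in> {1..J} \<Longrightarrow> conjugate_exponents (p j) (ereal (q j))"
    and M: "M \<in> block_space J m n" and pos: "0 < norm_vq J L \<beta> q M"
  shows "Z_ball J L \<beta> q M \<in> block_space J m n"
    and "norm_wp J L \<alpha> p (Z_ball J L \<beta> q M) \<le> 1"
    and "block_inner J M (Z_ball J L \<beta> q M) = - norm_vq J L \<beta> q M"
proof -
  define N where "N = norm_vq J L \<beta> q M"
  define a where "a j = L j powr (-1/2) * schatten_norm (ereal (q j)) (M j)" for j
  have a: "0 \<le> a j" for j by (simp add: a_def)
  have N: "N = lr_norm (ereal \<beta>) (map a [1..<Suc J])" "0 < N"
    using pos by (simp_all add: N_def norm_vq_def a_def[abs_def] del: upt_Suc)
  define w where "w j = (a j / N) powr (\<beta> - 1)" for j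
  have Zb: "Z_ball J L \<beta> q M j = (L j powr (-1/2) * w j) \<cdot>\<^sub>m Delta_b (q j) (M j)" for j
    by (simp add: Z_ball_def w_def a_def N_def)
  have Mj: "M j \<in> carrier_mat (m j) (n j)" if "j \<in> {1..J}" for j
    using M that by (auto simp: block_space_def)
  have Delta: "Delta_b (q j) (M j) \<in> carrier_mat (m j) (n j)"
      "trace_inner (M j) (Delta_b (q j) (M j)) = - schatten_norm (ereal (q j)) (M j)"
      "schatten_norm (p j) (Delta_b (q j) (M j)) \<le> 1" if "j \<in> {1..J}" for j
    using Delta_b_minimizes[OF Mj[OF that] conj_j[OF that] p[OF that]] by auto
  have p1: "1 \<le> p j" if "j \<in> {1..J}" for j
    using conj_j[OF that] by (simp add: conjugate_exponents_def)
  have \<beta>: "1 \<le> \<beta>" using conj by (simp add: conjugate_exponents_def one_ereal_def)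
  have set: "set [1..<Suc J] = {1..J}" by auto
  show "Z_ball J L \<beta> q M \<in> block_space J m n" using Delta(1) by (simp add: block_space_def Zb)
  show "norm_wp J L \<alpha> p (Z_ball J L \<beta> q M) \<le> 1"
    unfolding norm_wp_def
  proof (rule lr_norm_dual_vector_le[OF conj _ N])
    fix j assume "j \<in> set [1..<Suc J]"
    then have j: "j \<in> {1..J}" by auto
    have "L j powr (1/2) * schatten_norm (p j) (Z_ball J L \<beta> q M j)
        = w j * schatten_norm (p j) (Delta_b (q j) (M j))"
      using L[OF j] unfolding Zb schatten_norm_smult[OF Delta(1)[OF j] p1[OF j]]
      by (simp add: abs_mult w_def powr_minus field_simps)
    also have "\<dots> \<le> w j" using Delta(3)[OF j] by (intro mult_left_le) (auto simp: w_def)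
    finally show "\<bar>L j powr (1/2) * schatten_norm (p j) (Z_ball J L \<beta> q M j)\<bar>
        \<le> (\<bar>a j\<bar> / N) powr (\<beta> - 1)"
      using a[of j] by (simp add: w_def abs_mult)
  qed simp
  have "block_inner J M (Z_ball J L \<beta> q M) = (\<Sum>j\<in>{1..J}. - (\<bar>a j\<bar> * (\<bar>a j\<bar> / N) powr (\<beta> - 1)))"
    unfolding block_inner_def
  proof (rule sum.cong[OF refl])
    fix j assume j: "j \<in> {1..J}"
    show "trace_inner (M j) (Z_ball J L \<beta> q M j) = - (\<bar>a j\<bar> * (\<bar>a j\<bar> / N) powr (\<beta> - 1))"
      unfolding Zb trace_inner_smult[OF Mj[OF j] Delta(1)[OF j]] Delta(2)[OF j]
      using a[of j] by (simp add: w_def) (simp add: a_def)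
  qed
  also have "\<dots> = - N"
    using sum_dual_vector[OF \<beta> _ N] unfolding set by (simp add: sum_negf)
  finally show "block_inner J M (Z_ball J L \<beta> q M) = - norm_vq J L \<beta> q M" by (simp add: N_def)
qed

section \<open>The ball and regularization problems\<close>

theorem lemma2:
  fixes J :: nat and m n :: "nat \<Rightarrow> nat" and L :: "nat \<Rightarrow> real"
    and \<alpha> :: ereal and \<beta> :: real and p :: "nat \<Rightarrow> ereal" and q :: "nat \<Rightarrow> real"
    and M :: "nat \<Rightarrow> real mat"
  assumes "\<And>j. j \<in> {1..J} \<Longrightarrow> 0 < L j"
    and "2 \<le> \<alpha>" and "\<beta> \<in> {1..2}" and "conjugate_exponents \<alpha> (ereal \<beta>)"
    and "\<And>j. j \<in> {1..J} \<Longrightarrow> 2 \<le> p j"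
    and "\<And>j. j \<in> {1..J} \<Longrightarrow> q j \<in> {1..2}"
    and "\<And>j. j \<in> {1..J} \<Longrightarrow> conjugate_exponents (p j) (ereal (q j))"
    and "M \<in> block_space J m n"
  shows "(norm_vq J L \<beta> q M = 0 \<longrightarrow>
            ball_minimizer J m n L \<alpha> p M (\<lambda>j. 0\<^sub>m (m j) (n j)) \<and>
            reg_minimizer J m n L \<alpha> p M (\<lambda>j. 0\<^sub>m (m j) (n j))) \<and>
         (norm_vq J L \<beta> q M > 0 \<longrightarrow>
            ball_minimizer J m n L \<alpha> p M (Z_ball J L \<beta> q M) \<and>
            reg_minimizer J m n L \<alpha> p M (Z_reg J L \<beta> q M))"
proof -
  define N where "N = norm_vq J L \<beta> q M"
  define W where "W = norm_wp J L \<alpha> p"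
  have N: "0 \<le> N" by (simp add: N_def norm_vq_def)
  have W: "0 \<le> W Z" for Z by (simp add: W_def norm_wp_def)
  have \<alpha>1: "1 \<le> \<alpha>" using assms(4) by (simp add: conjugate_exponents_def)
  have p1: "1 \<le> p j" if "j \<in> {1..J}" for j
    using assms(7)[OF that] by (simp add: conjugate_exponents_def)
  have lower: "- (N * W Z) \<le> block_inner J M Z" if "Z \<in> block_space J m n" for Z
  proof -
    have "\<bar>block_inner J M Z\<bar> \<le> N * W Z"
      unfolding N_def W_def
      by (rule block_inner_Hoelder[where m = m and n = n]) (use assms that in auto)
    then show ?thesis by simp
  qed
  have lower_ball: "- N \<le> block_inner J M Z" if "Z \<in> block_space J m n" "W Z \<le> 1" for Z
    using lower[OF that(1)] mult_left_le[OF that(2) N] by linarith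
  have lower_reg: "- (1/2 * N\<^sup>2) \<le> block_inner J M Z + 1/2 * (W Z)\<^sup>2" if "Z \<in> block_space J m n" for Z
  proof -
    have "0 \<le> (N - W Z)\<^sup>2" by simp
    then show ?thesis using lower[OF that] by (simp add: power2_diff)
  qed
  \<comment> \<open>From here on, optimality only requires a feasible point that reaches the lower
    bound.\<close>
  have ball: "ball_minimizer J m n L \<alpha> p M Z"
    if "Z \<in> block_space J m n" "W Z \<le> 1" "block_inner J M Z = - N" for Z
    using that lower_ball unfolding ball_minimizer_def is_arg_min_def W_def[symmetric]
    by (auto simp: not_less)
  have reg: "reg_minimizer J m n L \<alpha> p M Z"
    if "Z \<in> block_space J m n" "block_inner J M Z + 1/2 * (W Z)\<^sup>2 \<le> - (1/2 * N\<^sup>2)" for Z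
    using that lower_reg order_trans[OF that(2) lower_reg]
    unfolding reg_minimizer_def is_arg_min_def W_def[symmetric] by (auto simp: not_less)
  have zero: "(\<lambda>j. 0\<^sub>m (m j) (n j)) \<in> block_space J m n" by (simp add: block_space_def)
  have W_smult: "W (\<lambda>j. c \<cdot>\<^sub>m Z j) = \<bar>c\<bar> * W Z" if "Z \<in> block_space J m n" for c Z
    unfolding W_def by (rule norm_wp_smult[OF that \<alpha>1 p1])
  have W_zero: "W (\<lambda>j. 0\<^sub>m (m j) (n j)) = 0"
    using W_smult[OF zero, of 0] by simp
  have inner_zero: "block_inner J M (\<lambda>j. 0\<^sub>m (m j) (n j)) = 0"
    using assms(8) by (auto simp: block_inner_def block_space_def trace_inner_sum intro!: sum.neutral)
  show ?thesis
  proof (intro conjI impI)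
    assume "norm_vq J L \<beta> q M = 0"
    then have "N = 0" by (simp add: N_def)
    then show "ball_minimizer J m n L \<alpha> p M (\<lambda>j. 0\<^sub>m (m j) (n j))"
      "reg_minimizer J m n L \<alpha> p M (\<lambda>j. 0\<^sub>m (m j) (n j))"
      by (auto intro!: ball reg simp: zero W_zero inner_zero)
  next
    assume pos: "0 < norm_vq J L \<beta> q M"
    have Zb: "Z_ball J L \<beta> q M \<in> block_space J m n" "W (Z_ball J L \<beta> q M) \<le> 1"
      "block_inner J M (Z_ball J L \<beta> q M) = - N"
      unfolding N_def W_def using assms pos
      by (intro Z_ball_dual_norm_attained[where \<alpha> = \<alpha> and p = p and J = J]; simp)+
    show "ball_minimizer J m n L \<alpha> p M (Z_ball J L \<beta> q M)" by (rule ball[OF Zb])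
    have Zr: "Z_reg J L \<beta> q M = (\<lambda>j. N \<cdot>\<^sub>m Z_ball J L \<beta> q M j)"
      by (simp add: fun_eq_iff Z_reg_def N_def)
    have "block_inner J M (Z_reg J L \<beta> q M) = N * block_inner J M (Z_ball J L \<beta> q M)"
      using assms(8) Zb(1) unfolding Zr block_inner_def sum_distrib_left
      by (intro sum.cong trace_inner_smult[of _ "m _" "n _"]) (auto simp: block_space_def)
    \<comment> \<open>An upper bound on the norm is enough: the inner product is -N^2, so the
      objective is at most -N^2 + N^2/2, which is the lower bound.\<close>
    moreover have "W (Z_reg J L \<beta> q M) \<le> N"
      using W_smult[OF Zb(1), of N] mult_left_le[OF Zb(2) N] N by (simp add: Zr)
    then have "(W (Z_reg J L \<beta> q M))\<^sup>2 \<le> N\<^sup>2" using W by (rule power_mono)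
    ultimately show "reg_minimizer J m n L \<alpha> p M (Z_reg J L \<beta> q M)"
      using Zb(1,3) by (intro reg) (auto simp: Zr block_space_def power2_eq_square)
  qed
qed

end
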